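(* Let $\hat R_1^*,\hat R_2^*,\ldots$ be the sequence of payouts (including Futurity awards) of the generalized Futurity slot machine, as defined in the context, starting in an arbitrary initial state $(i_0,j_0)\in\{0,1,\ldots,I-1\}\times\{0,1,\ldots,J-1\}$. Let $\mu^*:=\bar\mu/I$ and $(\sigma^* )^2:=\bar\sigma^2/I$, where $\bar\mu$ and $\bar\sigma^2$ are defined in the context, and assume $\bar\sigma^2>0$. Then $$\frac{\hat R_1^*+\cdots+\hat R_n^*-n\mu^*}{\sqrt{n(\sigma^* )^2}}\;\xrightarrow{\;d\;}\;N(0,1)\qquad\text{as } n\to\infty,$$ that is, the left-hand side converges in distribution to a standard normal random variable.
   Context: Generalized Futurity slot machine. Let $J\ge2$ and $d\ge1$ be integers and $I:=dJ$. For each $i\in\{0,1,\ldots,I-1\}$ a bounded nonnegative payout distribution is given (the payout distribution in cam position $i$); it has probability $p_i$ of being nonzero, where $0<p_i<1$, mean $\mu_i$, and variance $\sigma_i^2$. Payouts from initial state $(i_0,j_0)$. Let $\hat R_1,\hat R_2,\ldots$ be independent, with $\hat R_n$ having the payout distribution in cam position $i\in\{0,\ldots,I-1\}$, $i\equiv i_0+n-1\pmod I$ (payouts excluding Futurity awards). Let $\hat Y_0=j_0$ and, for $n\ge1$, $\hat Y_n=\hat Y_{n-1}+1$ if $\hat R_n=0$ and $\hat Y_{n-1}\le J-2$, and $\hat Y_n=0$ otherwise (pointer position: number of consecutive losses, reset to $0$ after a win or after $J$ consecutive losses). The payout at coup $n$, including the return of the $J$ lost coins after $J$ consecutive losses (Futurity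 award), is $$\hat R_n^*:=\hat R_n+J\cdot1_{\{\hat Y_{n-1}=J-1,\;\hat R_n=0\}},\qquad n\ge1.$$ Parameters $\bar\mu$ and $\bar\sigma^2$. Let $\{R_n\}_{n\in\mathbf{Z}}$ be independent random variables indexed by the integers, with $R_n$ having the payout distribution in cam position $i\in\{0,\ldots,I-1\}$, $i\equiv n-1\pmod I$. Define $$R_n^*:=R_n+J\sum_{k=1}^\infty 1_{\{R_{n-kJ}>0,\;R_{n-kJ+1}=\cdots=R_{n-1}=R_n=0\}},\qquad n\in\mathbf{Z},$$ and $$S_k^*:=R_{kI+1}^*+\cdots+R_{(k+1)I}^*,\qquad k\in\mathbf{Z}.$$ The sequence $\{S_k^*\}_{k\in\mathbf{Z}}$ is stationary. Put $$\bar\mu:=\mathrm{E}[S_0^*],\qquad \bar\sigma^2:=\operatorname{Var}(S_0^* )+2\sum_{m=1}^\infty\operatorname{Cov}(S_0^*,S_m^* ).$$ *)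

theory Defs
  imports "HOL-Probability.Probability"
begin

(* Here r is one realization of the payouts excluding Futurity awards; the value r 0 is not used,
   since coups are numbered from 1. *)
primrec pointer :: "nat \<Rightarrow> nat \<Rightarrow> (nat \<Rightarrow> real) \<Rightarrow> nat \<Rightarrow> nat" where
  "pointer J j0 r 0 = j0"
| "pointer J j0 r (Suc n) =
    (if r (Suc n) = 0 \<and> pointer J j0 r n \<le> J - 2 then pointer J j0 r n + 1 else 0)"

definition futurity_payout :: "nat \<Rightarrow> nat \<Rightarrow> (nat \<Rightarrow> real) \<Rightarrow> nat \<Rightarrow> real" where
  "futurity_payout J j0 r n =
    r n + real J * of_bool (pointer J j0 r (n - 1) = J - 1 \<and> r n = 0)"

(* Along the two-sided realization r, the summand with index k says that the losing streak in
   progress at coup n has length exactly (k + 1) J; hence at most one summand is nonzero. *)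
definition stationary_payout :: "nat \<Rightarrow> (int \<Rightarrow> real) \<Rightarrow> int \<Rightarrow> real" where
  "stationary_payout J r n =
    r n + real J * (\<Sum>k::nat. of_bool (r (n - int ((k + 1) * J)) > 0 \<and>
                      (\<forall>m\<in>{n - int ((k + 1) * J) + 1..n}. r m = 0)))"

definition cycle_payout :: "nat \<Rightarrow> nat \<Rightarrow> (int \<Rightarrow> real) \<Rightarrow> int \<Rightarrow> real" where
  "cycle_payout J I r k = (\<Sum>n\<in>{k * int I + 1..(k + 1) * int I}. stationary_payout J r n)"

definition covariance :: "'a measure \<Rightarrow> ('a \<Rightarrow> real) \<Rightarrow> ('a \<Rightarrow> real) \<Rightarrow> real" where
  "covariance M X Y =
    prob_space.expectation M
      (\<lambda>x. (X x - prob_space.expectation M X) * (Y x - prob_space.expectation M Y))"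

definition mu_bar :: "nat \<Rightarrow> nat \<Rightarrow> 'a measure \<Rightarrow> (int \<Rightarrow> 'a \<Rightarrow> real) \<Rightarrow> real" where
  "mu_bar J I M R = prob_space.expectation M (\<lambda>x. cycle_payout J I (\<lambda>n. R n x) 0)"

definition sigma_sq_bar :: "nat \<Rightarrow> nat \<Rightarrow> 'a measure \<Rightarrow> (int \<Rightarrow> 'a \<Rightarrow> real) \<Rightarrow> real" where
  "sigma_sq_bar J I M R =
    prob_space.variance M (\<lambda>x. cycle_payout J I (\<lambda>n. R n x) 0) +
    2 * (\<Sum>m::nat. covariance M (\<lambda>x. cycle_payout J I (\<lambda>n. R n x) 0)
                                (\<lambda>x. cycle_payout J I (\<lambda>n. R n x) (int m + 1)))"

end

(* Cut time into blocks of l cycles and reset the pointer at the start of every block. Before the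
   first win the quantity J * awards + pointer grows by one per coup, and after it the pointer no
   longer depends on its initial value; hence resetting changes the payout of a block, however long,
   by at most one Futurity award. The reset blocks are independent and identically distributed, so
   the classical central limit theorem applies to them. The awards lost by resetting have covariances
   that decay geometrically with the distance of the blocks, so their sum over n coups has variance
   at most C n / l. As l grows this becomes negligible, and the variance of a block divided by l
   tends to sigma_sq_bar, because a block differs from a sum of l stationary cycle payouts by at
   most J. The payouts of the machine started in (i0, j0) have the law of the two-sided sequence
   read from time i0 on, and differ from the reset payouts by a bounded amount. *)
theory Submission
  imports Defs
begin

section \<open>Pointer and payouts along a realization\<close>

text \<open>Losing streaks can be arbitrarily long, so cycle payouts at any distance are dependent
  and the classical theorem cannot be applied to them directly. Resetting the pointer restores
  independence at a price per block that does not depend on the block length. Still, n / (l * I)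
  resets, each costing up to J, add up to order n, which is too much against sqrt n if they are
  bounded one by one. The lost awards are therefore centred and estimated in second moment, which
  gives order sqrt (n / l). Their means never have to be computed: the mean of the undivided sum is
  within J of a multiple of \<open>mu_bar\<close>, and this fixes the centring. The limits are taken
  in a fixed order: for a given accuracy l is chosen once and kept while n tends to infinity.
  Characteristic functions make this possible, since their difference at t is at most |t| times the
  mean absolute difference of the variables.\<close>

definition payout_sum :: "nat \<Rightarrow> nat \<Rightarrow> (nat \<Rightarrow> real) \<Rightarrow> nat \<Rightarrow> real" where
  "payout_sum J j s n = (\<Sum>k=1..n. futurity_payout J j s k)"

text \<open>Time b plays the part of coup 0, whose payout is never read; the first coup of the
  restarted machine is at time b + 1.\<close>

definition payouts_after :: "int \<Rightarrow> (int \<Rightarrow> real) \<Rightarrow> nat \<Rightarrow> real" where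
  "payouts_after b r = (\<lambda>m. r (b + int m))"

text \<open>A block with the pointer reset at its start. It reads r only at the times b + 1, ..., b
  + n, so blocks over disjoint windows become independent.\<close>

definition fresh_sum :: "nat \<Rightarrow> (int \<Rightarrow> real) \<Rightarrow> int \<Rightarrow> nat \<Rightarrow> real" where
  "fresh_sum J r b n = payout_sum J 0 (payouts_after b r) n"

lemma payout_sum_0 [simp]: "payout_sum J j s 0 = 0"
  by (simp add: payout_sum_def)

lemma payout_sum_Suc [simp]:
  "payout_sum J j s (Suc n) = payout_sum J j s n + futurity_payout J j s (Suc n)"
  by (simp add: payout_sum_def)

lemma payouts_after_shift: "(\<lambda>k. payouts_after b r (m + k)) = payouts_after (b + int m) r"
  by (simp add: payouts_after_def add.assoc)

lemma pointer_less: "J \<ge> 2 \<Longrightarrow> j < J \<Longrightarrow> pointer J j s n < J"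
  by (induction n) auto

lemma pointer_add: "pointer J j s (m + n) = pointer J (pointer J j s m) (\<lambda>k. s (m + k)) n"
  by (induction n) auto

lemma futurity_payout_add:
  "n \<ge> 1 \<Longrightarrow> futurity_payout J j s (m + n) = futurity_payout J (pointer J j s m) (\<lambda>k. s (m + k)) n"
  using pointer_add[of J j s m "n - 1"] by (simp add: futurity_payout_def)

lemma payout_sum_add:
  "payout_sum J j s (m + n) = payout_sum J j s m + payout_sum J (pointer J j s m) (\<lambda>k. s (m + k)) n"
  using futurity_payout_add[of "Suc _" J j s m] by (induction n) auto

lemma pointer_cong: "(\<And>k. k \<in> {1..n} \<Longrightarrow> s k = s' k) \<Longrightarrow> pointer J j s n = pointer J j s' n"
  by (induction n) auto

lemma payout_sum_cong:
  assumes "\<And>k. k \<in> {1..n} \<Longrightarrow> s k = s' k"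
  shows "payout_sum J j s n = payout_sum J j s' n"
proof -
  have "pointer J j s (k - 1) = pointer J j s' (k - 1)" if "k \<in> {1..n}" for k
    using that by (intro pointer_cong assms) auto
  with assms show ?thesis
    by (auto simp: payout_sum_def futurity_payout_def intro!: sum.cong)
qed

lemma fresh_sum_cong:
  assumes "\<And>k. k \<in> {b+1..b+int n} \<Longrightarrow> r k = r' k"
  shows "fresh_sum J r b n = fresh_sum J r' b n"
  unfolding fresh_sum_def using assms by (intro payout_sum_cong) (auto simp: payouts_after_def)

lemma fresh_sum_shift: "fresh_sum J r (b + c) n = fresh_sum J (\<lambda>i. r (i + c)) b n"
  by (simp add: fresh_sum_def payouts_after_def algebra_simps)

text \<open>A win sends both pointers to 0, and from then on the same payouts drive them. All decay
  of dependence comes from this.\<close>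

lemma pointer_forget:
  "s k \<noteq> 0 \<Longrightarrow> k \<in> {1..m} \<Longrightarrow> pointer J j s m = pointer J j' s m"
  by (induction m) (auto simp: le_Suc_eq)

text \<open>Coupling: the two pointers take turns in leading, and the trailing machine has always
  paid the same number of awards or exactly one fewer.\<close>
lemma payout_sum_diff_aux:
  assumes "J \<ge> 2" "j \<le> j'" "j' < J"
  shows "payout_sum J j' s n = payout_sum J j s n \<and> pointer J j s n \<le> pointer J j' s n \<or>
    payout_sum J j' s n = payout_sum J j s n + J \<and> pointer J j' s n \<le> pointer J j s n"
proof (induction n)
  case 0
  then show ?case using assms by simp
next
  case (Suc n)
  have "pointer J j s n < J" "pointer J j' s n < J"
    using assms by (auto intro!: pointer_less)
  with Suc show ?case using assms(1)
    by (auto simp: futurity_payout_def)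
qed

lemma payout_sum_diff:
  assumes "J \<ge> 2" "j < J" "j' < J"
  shows "\<bar>payout_sum J j' s n - payout_sum J j s n\<bar> \<le> J"
  using payout_sum_diff_aux[of J j j' s n] payout_sum_diff_aux[of J j' j s n] assms
  by (cases "j \<le> j'") auto

text \<open>In the coupling, pointer 0 is the smaller initial value whatever j is, and this fixes
  the sign of the difference.\<close>

lemma payout_sum_diff_0:
  assumes "J \<ge> 2" "j < J"
  shows "0 \<le> payout_sum J j s n - payout_sum J 0 s n" "payout_sum J j s n - payout_sum J 0 s n \<le> J"
  using payout_sum_diff_aux[of J 0 j s n] assms by auto

lemma payout_sum_bounds:
  assumes "\<And>k. 0 \<le> s k \<and> s k \<le> B"
  shows "0 \<le> payout_sum J j s n \<and> payout_sum J j s n \<le> n * (B + J)"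
proof (induction n)
  case (Suc n)
  have "0 \<le> futurity_payout J j s (Suc n)" "futurity_payout J j s (Suc n) \<le> B + J"
    using assms[of "Suc n"] by (auto simp: futurity_payout_def)
  with Suc show ?case by (auto simp: algebra_simps)
qed simp

lemma fresh_sum_bounds:
  assumes "\<And>k. 0 \<le> r k \<and> r k \<le> B"
  shows "0 \<le> fresh_sum J r b n \<and> fresh_sum J r b n \<le> n * (B + J)"
  unfolding fresh_sum_def using assms by (intro payout_sum_bounds) (auto simp: payouts_after_def)

lemma fresh_sum_add:
  "fresh_sum J r b (m + n) = fresh_sum J r b m
     + payout_sum J (pointer J 0 (payouts_after b r) m) (payouts_after (b + int m) r) n"
  unfolding fresh_sum_def payout_sum_add payouts_after_shift ..

text \<open>The extra award paid in a block because the pointer was not reset at its start.\<close>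
definition carry :: "nat \<Rightarrow> (int \<Rightarrow> real) \<Rightarrow> int \<Rightarrow> nat \<Rightarrow> nat \<Rightarrow> real" where
  "carry J r b m n = fresh_sum J r b (m + n) - fresh_sum J r b m - fresh_sum J r (b + int m) n"

lemma carry_eq:
  "carry J r b m n = payout_sum J (pointer J 0 (payouts_after b r) m) (payouts_after (b + int m) r) n
     - fresh_sum J r (b + int m) n"
  unfolding carry_def fresh_sum_add by simp

lemma carry_bounds:
  assumes "J \<ge> 2"
  shows "0 \<le> carry J r b m n" "carry J r b m n \<le> J"
proof -
  have "pointer J 0 (payouts_after b r) m < J"
    using assms by (intro pointer_less) auto
  from payout_sum_diff_0[OF assms this, of "payouts_after (b + int m) r" n]
  show "0 \<le> carry J r b m n" "carry J r b m n \<le> J"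
    unfolding carry_eq by (auto simp: fresh_sum_def)
qed

text \<open>Locates the times that a carry reads, as needed for its independence from payouts
  outside that window.\<close>

lemma carry_cong:
  assumes "\<And>k. k \<in> {b+1..b+int m+int n} \<Longrightarrow> r k = r' k"
  shows "carry J r b m n = carry J r' b m n"
proof -
  have "fresh_sum J r b (m + n) = fresh_sum J r' b (m + n)"
    "fresh_sum J r b m = fresh_sum J r' b m"
    "fresh_sum J r (b + int m) n = fresh_sum J r' (b + int m) n"
    using assms by (auto intro!: fresh_sum_cong)
  then show ?thesis by (simp add: carry_def)
qed

text \<open>A win during the m' coups before the block erases the first m coups, so the carry is the
  same as if the machine had been started at b + m. Away from the event of no win this replaces a
  carry by a variable that is independent of the past.\<close>

lemma carry_forget:
  assumes "r k \<noteq> 0" "k \<in> {b + int m + 1..b + int m + int m'}"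
  shows "carry J r b (m + m') n = carry J r (b + int m) m' n"
proof -
  let ?s = "payouts_after (b + int m) r"
  define k' where "k' = nat (k - (b + int m))"
  have "?s k' \<noteq> 0" "k' \<in> {1..m'}"
    using assms by (auto simp: k'_def payouts_after_def)
  then have "pointer J (pointer J 0 (payouts_after b r) m) ?s m' = pointer J 0 ?s m'"
    by (rule pointer_forget)
  then have "pointer J 0 (payouts_after b r) (m + m') = pointer J 0 ?s m'"
    by (simp add: pointer_add payouts_after_shift)
  then show ?thesis
    by (simp add: carry_eq add.assoc)
qed

lemma fresh_sum_blocks:
  "fresh_sum J r 0 (m * L) = (\<Sum>j<m. fresh_sum J r (int (j * L)) L) + (\<Sum>j<m. carry J r 0 (j * L) L)"
  by (induction m) (simp_all add: carry_def fresh_sum_def add.commute)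

section \<open>The two-sided payouts\<close>

text \<open>The win at a anchors the streak: its length l is at most m, and pointer 0 just after a
  win is the correct start. The pointer forgets how many full groups of J losses have gone by, hence
  l mod J.\<close>

lemma pointer_eq_streak:
  assumes "J \<ge> 2" "r a \<noteq> 0"
  shows "\<exists>l\<le>m. r (a + int m - int l) \<noteq> 0 \<and> (\<forall>i\<in>{a + int m - int l + 1..a + int m}. r i = 0)
    \<and> pointer J 0 (payouts_after a r) m = l mod J"
proof (induction m)
  case 0
  then show ?case using assms by (auto simp: payouts_after_def)
next
  case (Suc m)
  then obtain l where l: "l \<le> m" "r (a + int m - int l) \<noteq> 0"
    "\<forall>i\<in>{a + int m - int l + 1..a + int m}. r i = 0"
    "pointer J 0 (payouts_after a r) m = l mod J" by blast
  show ?case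
  proof (cases "r (a + int (Suc m)) = 0")
    case False
    then show ?thesis
      by (intro exI[of _ 0]) (auto simp: payouts_after_def)
  next
    case True
    have "\<forall>i\<in>{a + int (Suc m) - int (Suc l) + 1..a + int (Suc m)}. r i = 0"
    proof
      fix i assume "i \<in> {a + int (Suc m) - int (Suc l) + 1..a + int (Suc m)}"
      then have "i \<in> {a + int m - int l + 1..a + int m} \<or> i = a + int (Suc m)" by auto
      with l(3) True show "r i = 0" by auto
    qed
    moreover have "pointer J 0 (payouts_after a r) (Suc m) = Suc l mod J"
    proof -
      have "l mod J < J" using assms(1) by simp
      then have "l mod J \<le> J - 2 \<longleftrightarrow> Suc (l mod J) \<noteq> J" using assms(1) by arith
      then show ?thesis using True l(4) by (simp add: payouts_after_def mod_Suc)
    qed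
    ultimately show ?thesis
      using l by (intro exI[of _ "Suc l"]) (auto simp: algebra_simps)
  qed
qed

text \<open>Links the series over streak lengths with the pointer. If l losses precede coup n, the
  summand k is nonzero exactly when n is a loss and (k + 1) J = l + 1. Such a k exists iff l mod J =
  J - 1, and then it is unique, so the series has at most one nonzero term.\<close>

lemma stationary_payout_eq:
  assumes J: "J \<ge> 2" and nonneg: "\<And>i. r i \<ge> 0" and a: "r a \<noteq> 0" and m: "m \<ge> 1"
  shows "stationary_payout J r (a + int m) = futurity_payout J 0 (payouts_after a r) m"
proof -
  let ?n = "a + int m"
  define Q where "Q k \<longleftrightarrow> r (?n - int ((k + 1) * J)) > 0 \<and>
                      (\<forall>m\<in>{?n - int ((k + 1) * J) + 1..?n}. r m = 0)" for k :: nat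
  \<comment> \<open>The streak is taken one coup before n, because \<open>futurity_payout\<close>
    tests the pointer before the coup.\<close>
  obtain l where l: "l \<le> m - 1" "r (a + int (m - 1) - int l) \<noteq> 0"
    "\<forall>i\<in>{a + int (m - 1) - int l + 1..a + int (m - 1)}. r i = 0"
    "pointer J 0 (payouts_after a r) (m - 1) = l mod J"
    using pointer_eq_streak[of J r a, OF J a, of "m - 1"] by blast
  have n1: "a + int (m - 1) = ?n - 1" using m by simp
  have Q_iff: "Q k \<longleftrightarrow> r ?n = 0 \<and> (k + 1) * J = l + 1" for k
  proof
    assume Q: "Q k"
    \<comment> \<open>The required streak is nonempty, so it contains coup n itself.\<close>
    have "(k + 1) * J \<ge> 1" using J by (simp add: Suc_le_eq)
    then have "?n \<in> {?n - int ((k + 1) * J) + 1..?n}"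
      unfolding atLeastAtMost_iff by linarith
    then have n0: "r ?n = 0" using Q unfolding Q_def by blast
    have "\<not> (k + 1) * J < l + 1"
    proof
      assume less: "(k + 1) * J < l + 1"
      have "r (?n - int ((k + 1) * J)) = 0"
        using less \<open>(k + 1) * J \<ge> 1\<close> n1 unfolding atLeastAtMost_iff
        by (intro l(3)[rule_format]) (unfold atLeastAtMost_iff, linarith)
      with Q show False by (auto simp: Q_def)
    qed
    moreover have "\<not> (k + 1) * J > l + 1"
    proof
      assume "(k + 1) * J > l + 1"
      then have "?n - 1 - int l \<in> {?n - int ((k + 1) * J) + 1..?n}"
        unfolding atLeastAtMost_iff by linarith
      with Q have "r (?n - 1 - int l) = 0" unfolding Q_def by blast
      with l(2)[unfolded n1] show False by contradiction
    qed
    ultimately show "r ?n = 0 \<and> (k + 1) * J = l + 1" using n0 by simp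
  next
    assume *: "r ?n = 0 \<and> (k + 1) * J = l + 1"
    have eq: "?n - int ((k + 1) * J) = ?n - 1 - int l" using * by simp
    have "r i = 0" if "i \<in> {?n - 1 - int l + 1..?n}" for i
      using that l(3) * unfolding n1 by (cases "i = ?n") auto
    moreover have "r (?n - 1 - int l) > 0"
      using l(2) nonneg[of "?n - 1 - int l"] unfolding n1 by simp
    ultimately show "Q k" unfolding Q_def eq by blast
  qed
  have "(\<Sum>k. of_bool (Q k)) = (of_bool (l mod J = J - 1 \<and> r ?n = 0) :: real)"
  proof (cases "l mod J = J - 1 \<and> r ?n = 0")
    case True
    define k where "k = l div J"
    have "l = J * k + (J - 1)" unfolding k_def using True by (metis mult_div_mod_eq)
    then have kl: "(k + 1) * J = l + 1" using J by (simp add: algebra_simps)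
    have "Q k' \<longleftrightarrow> k' = k" for k'
    proof -
      have "(k' + 1) * J = (k + 1) * J \<longleftrightarrow> k' = k"
        using J by (subst mult_cancel2) auto
      then show ?thesis using True unfolding Q_iff kl[symmetric] by blast
    qed
    then have "(\<Sum>i. of_bool (Q i)) = (\<Sum>i. if i = k then 1 else 0 :: real)"
      by (intro arg_cong[of _ _ suminf]) auto
    also have "\<dots> = 1"
      using sums_single[of k "\<lambda>_. 1::real"] by (simp add: sums_iff)
    finally show ?thesis using True by simp
  next
    case False
    have "\<not> Q k" for k
    proof
      assume "Q k"
      then have *: "r ?n = 0" "(k + 1) * J = l + 1" using Q_iff by auto
      then have "l = (J - 1) + k * J" using J by (simp add: algebra_simps)
      then have "l mod J = J - 1" using J by (simp only: mod_mult_self1) simp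
      with * False show False by simp
    qed
    then show ?thesis using False by simp
  qed
  then show ?thesis
    unfolding stationary_payout_def futurity_payout_def l(4) Q_def
    by (simp add: payouts_after_def)
qed

text \<open>Over any window the stationary payouts are those of an ordinary machine whose initial
  pointer is inherited from an earlier win a. Comparing with a reset machine is then a matter of two
  initial pointers.\<close>

lemma sum_stationary_payout:
  assumes J: "J \<ge> 2" and nonneg: "\<And>i. r i \<ge> 0" and a: "r a \<noteq> 0" "a \<le> b"
  shows "(\<Sum>i\<in>{b+1..b+int n}. stationary_payout J r i) =
    payout_sum J (pointer J 0 (payouts_after a r) (nat (b - a))) (payouts_after b r) n"
proof (induction n)
  case (Suc n)
  define c where "c = nat (b - a)"
  have b: "b = a + int c" using a by (simp add: c_def)
  have "{b+1..b+int (Suc n)} = insert (b + int (Suc n)) {b+1..b+int n}" by auto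
  then have "(\<Sum>i\<in>{b+1..b+int (Suc n)}. stationary_payout J r i) =
     stationary_payout J r (b + int (Suc n)) + (\<Sum>i\<in>{b+1..b+int n}. stationary_payout J r i)"
    by simp
  also have "stationary_payout J r (b + int (Suc n)) =
      futurity_payout J 0 (payouts_after a r) (c + Suc n)"
    using stationary_payout_eq[of J r a "c + Suc n"] assms by (simp add: b ac_simps)
  also have "\<dots> = futurity_payout J (pointer J 0 (payouts_after a r) c) (payouts_after b r) (Suc n)"
    by (subst futurity_payout_add) (simp_all add: payouts_after_shift b)
  finally show ?case using Suc by (simp add: c_def)
qed simp

text \<open>The stationary payout looks only into the past; this makes it independent of anything
  built from later payouts.\<close>

lemma stationary_payout_cong:
  assumes "\<And>i. i \<le> n \<Longrightarrow> r i = r' i"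
  shows "stationary_payout J r n = stationary_payout J r' n"
proof -
  have "r (n - int k) = r' (n - int k)" for k using assms by simp
  then show ?thesis using assms by (simp add: stationary_payout_def del: of_nat_mult of_nat_add)
qed

lemma cycle_payout_cong:
  assumes "\<And>i. i \<le> (k + 1) * int I \<Longrightarrow> r i = r' i"
  shows "cycle_payout J I r k = cycle_payout J I r' k"
  unfolding cycle_payout_def using assms
  by (intro sum.cong refl stationary_payout_cong) auto

lemma stationary_payout_shift:
  "stationary_payout J r (n + c) = stationary_payout J (\<lambda>i. r (i + c)) n"
proof -
  have *: "(\<forall>m\<in>{n + c - int ((k + 1) * J) + 1..n + c}. r m = 0) \<longleftrightarrow>
    (\<forall>m\<in>{n - int ((k + 1) * J) + 1..n}. r (m + c) = 0)" for k
  proof -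
    have image: "{n + c - int ((k + 1) * J) + 1..n + c} = (\<lambda>m. m + c) ` {n - int ((k + 1) * J) + 1..n}"
      unfolding image_add_atLeastAtMost' by (simp only: algebra_simps)
    show ?thesis unfolding image by blast
  qed
  show ?thesis unfolding stationary_payout_def *
    by (simp only: algebra_simps)
qed

lemma cycle_payout_shift:
  "cycle_payout J I r (k + c) = cycle_payout J I (\<lambda>i. r (i + c * int I)) k"
proof -
  have *: "{(k + c) * int I + 1..(k + c + 1) * int I} = (\<lambda>m. m + c * int I) ` {k * int I + 1..(k + 1) * int I}"
    unfolding image_add_atLeastAtMost' by (simp only: algebra_simps)
  show ?thesis
    unfolding cycle_payout_def * by (subst sum.reindex) (simp_all add: stationary_payout_shift)
qed

lemma cycle_payout_altdef:
  "cycle_payout J I r k = (\<Sum>n\<in>{k * int I + 1..k * int I + int I}. stationary_payout J r n)"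
  by (simp add: cycle_payout_def algebra_simps)

text \<open>The interval is left in the form \<open>0+1..0+int (l * I)\<close> so that it matches
  the windows \<open>b+1..b+int n\<close> at b = 0.\<close>

lemma sum_cycle_payout:
  "(\<Sum>k<l. cycle_payout J I r (int k)) = (\<Sum>i\<in>{0+1..0+int (l * I)}. stationary_payout J r i)"
proof (induction l)
  case (Suc l)
  have "{0+1..0+int (Suc l * I)} = {0+1..0+int (l * I)} \<union> {int l * int I + 1..int l * int I + int I}"
    using mult_nonneg_nonneg[of "int l" "int I"] by (auto simp del: mult_nonneg_nonneg)
  moreover have "{0+1..0+int (l * I)} \<inter> {int l * int I + 1..int l * int I + int I} = {}"
    by auto
  ultimately have "(\<Sum>i\<in>{0+1..0+int (Suc l * I)}. stationary_payout J r i) =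
      (\<Sum>i\<in>{0+1..0+int (l * I)}. stationary_payout J r i) + cycle_payout J I r (int l)"
    unfolding cycle_payout_altdef by (subst sum.union_disjoint[symmetric]) auto
  then show ?case using Suc by simp
qed simp

section \<open>Approximation in mean of weakly convergent sequences\<close>

text \<open>The map taking x to exp (i t x) is Lipschitz with constant |t|.\<close>

lemma (in prob_space) norm_char_diff_le:
  assumes [measurable]: "random_variable borel X" "random_variable borel Y"
    and int: "integrable M (\<lambda>x. X x - Y x)"
  shows "norm (char (distr M borel X) t - char (distr M borel Y) t)
    \<le> \<bar>t\<bar> * expectation (\<lambda>x. \<bar>X x - Y x\<bar>)"
proof -
  have i: "integrable M (\<lambda>x. iexp (t * Z x))" if [measurable]: "random_variable borel Z" for Z
    by (rule integrable_const_bound[of _ 1]) auto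
  have "char (distr M borel X) t - char (distr M borel Y) t
      = (CLINT x|M. iexp (t * X x) - iexp (t * Y x))"
    by (subst Bochner_Integration.integral_diff[OF i i]) (simp_all add: char_def integral_distr)
  also have "norm \<dots> \<le> (\<integral>x. norm (iexp (t * X x) - iexp (t * Y x)) \<partial>M)"
    by (rule integral_norm_bound)
  also have "\<dots> \<le> (\<integral>x. \<bar>t\<bar> * \<bar>X x - Y x\<bar> \<partial>M)"
  proof (rule integral_mono)
    show "integrable M (\<lambda>x. norm (iexp (t * X x) - iexp (t * Y x)))"
      using i by auto
    show "integrable M (\<lambda>x. \<bar>t\<bar> * \<bar>X x - Y x\<bar>)" using int by auto
    show "norm (iexp (t * X x) - iexp (t * Y x)) \<le> \<bar>t\<bar> * \<bar>X x - Y x\<bar>" for x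
    proof -
      have "iexp (t * X x) - iexp (t * Y x) = iexp (t * Y x) * (iexp (t * (X x - Y x)) - 1)"
        by (simp add: algebra_simps flip: exp_add)
      then have "norm (iexp (t * X x) - iexp (t * Y x)) = norm (iexp (t * (X x - Y x)) - 1)"
        by (simp add: norm_mult)
      also have "\<dots> \<le> \<bar>t * (X x - Y x)\<bar>"
        using iexp_approx1[of "t * (X x - Y x)" 0] by simp
      finally show ?thesis by (simp add: abs_mult)
    qed
  qed
  finally show ?thesis by simp
qed

text \<open>The approximating sequence U may change with e, and closeness is asked only for large n.
  This is how a block length chosen in advance enters: for each t the characteristic functions are
  compared through U, and Levy continuity concludes.\<close>

lemma (in prob_space) weak_conv_m_approx:
  fixes Z :: "nat \<Rightarrow> 'a \<Rightarrow> real"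
  assumes Z[measurable]: "\<And>n. random_variable borel (Z n)" and \<mu>: "real_distribution \<mu>"
    and approx: "\<And>e. e > 0 \<Longrightarrow> \<exists>U. (\<forall>n. random_variable borel (U n)) \<and>
      weak_conv_m (\<lambda>n. distr M borel (U n)) \<mu> \<and>
      (\<forall>\<^sub>F n in sequentially. integrable M (\<lambda>x. Z n x - U n x) \<and>
         expectation (\<lambda>x. \<bar>Z n x - U n x\<bar>) \<le> e)"
  shows "weak_conv_m (\<lambda>n. distr M borel (Z n)) \<mu>"
proof (rule levy_continuity)
  show "real_distribution (distr M borel (Z n))" for n by (simp add: real_distribution_distr)
  show "real_distribution \<mu>" by fact
  fix t
  show "(\<lambda>n. char (distr M borel (Z n)) t) \<longlonglongrightarrow> char \<mu> t"
  proof (rule tendstoI)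
    fix e :: real assume e: "e > 0"
    \<comment> \<open>The added 1 keeps the denominator positive at t = 0.\<close>
    define e' where "e' = e / (2 * (\<bar>t\<bar> + 1))"
    have "e' > 0" using e by (simp add: e'_def add_nonneg_pos)
    then obtain U where U[measurable]: "\<And>n. random_variable borel (U n)"
      and conv: "weak_conv_m (\<lambda>n. distr M borel (U n)) \<mu>"
      and ev: "\<forall>\<^sub>F n in sequentially. integrable M (\<lambda>x. Z n x - U n x) \<and>
         expectation (\<lambda>x. \<bar>Z n x - U n x\<bar>) \<le> e'"
      using approx by meson
    have "(\<lambda>n. char (distr M borel (U n)) t) \<longlonglongrightarrow> char \<mu> t"
      using conv \<mu> by (intro levy_continuity1) (simp_all add: real_distribution_distr)
    then have "\<forall>\<^sub>F n in sequentially. dist (char (distr M borel (U n)) t) (char \<mu> t) < e / 2"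
      using e by (intro tendstoD) auto
    with ev show "\<forall>\<^sub>F n in sequentially. dist (char (distr M borel (Z n)) t) (char \<mu> t) < e"
    proof eventually_elim
      case (elim n)
      have "dist (char (distr M borel (Z n)) t) (char (distr M borel (U n)) t)
         \<le> \<bar>t\<bar> * expectation (\<lambda>x. \<bar>Z n x - U n x\<bar>)"
        unfolding dist_norm using elim by (intro norm_char_diff_le) auto
      also have "\<dots> \<le> \<bar>t\<bar> * e'" using elim by (intro mult_left_mono) auto
      also have "\<dots> \<le> (\<bar>t\<bar> + 1) * e'" using \<open>e' > 0\<close> by (intro mult_right_mono) auto
      also have "\<dots> = e / 2" by (simp add: e'_def add_nonneg_eq_0_iff field_simps)
      finally show ?case
        using elim dist_triangle[of "char (distr M borel (Z n)) t" "char \<mu> t" "char (distr M borel (U n)) t"]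
        by linarith
    qed
  qed
qed

lemma div_nat_asymp:
  assumes "L \<ge> 1"
  shows "(\<lambda>n::nat. real (n div L) / real n) \<longlonglongrightarrow> 1 / real L"
proof (rule tendsto_sandwich)
  have bd: "real n / L - 1 \<le> real (n div L)" "real (n div L) \<le> real n / L" for n
  proof -
    show "real n / L - 1 \<le> real (n div L)"
    proof -
      have "n < (n div L + 1) * L" using assms dividend_less_div_times[of L n] by simp
      then have "real n < real ((n div L + 1) * L)" by (simp only: of_nat_less_iff)
      then have "real n / L < real (n div L) + 1" using assms by (simp add: field_simps)
      then show ?thesis by simp
    qed
    show "real (n div L) \<le> real n / L" 
    proof -
      have "real (n div L * L) \<le> real n" by (simp only: of_nat_le_iff div_times_less_eq_dividend)
      then show ?thesis using assms by (simp add: field_simps)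
    qed
  qed
  show "\<forall>\<^sub>F n in sequentially. (real n / L - 1) / n \<le> real (n div L) / real n"
    by (intro always_eventually allI divide_right_mono bd) simp
  show "\<forall>\<^sub>F n in sequentially. real (n div L) / real n \<le> (real n / L) / n"
    by (intro always_eventually allI divide_right_mono bd) simp
  have "(\<lambda>n. 1 / real L - 1 / real n) \<longlonglongrightarrow> 1 / real L - 0"
    by (intro tendsto_intros lim_1_over_n)
  moreover have "\<forall>\<^sub>F n in sequentially. 1 / real L - 1 / real n = (real n / L - 1) / n"
    using eventually_gt_at_top[of 0] by eventually_elim (use assms in \<open>simp add: field_simps\<close>)
  ultimately show "(\<lambda>n. (real n / L - 1) / n) \<longlonglongrightarrow> 1 / L"
    by (auto intro: Lim_transform_eventually)
  have "\<forall>\<^sub>F n in sequentially. 1 / real L = (real n / L) / n"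
    using eventually_gt_at_top[of 0] by eventually_elim simp
  then show "(\<lambda>n. (real n / L) / n) \<longlonglongrightarrow> 1 / L"
    by (rule Lim_transform_eventually[OF tendsto_const])
qed

text \<open>Serves to replace the number of blocks m by n div L, which repeats values but tends to
  infinity.\<close>

lemma weak_conv_m_subseq:
  assumes "weak_conv_m P Q" "filterlim g at_top sequentially"
  shows "weak_conv_m (\<lambda>n. P (g n)) Q"
  using assms unfolding weak_conv_m_def weak_conv_def by (blast intro: filterlim_compose[where g = "\<lambda>n. cdf (P n) _"])

section \<open>Second moments of sums of weakly dependent variables\<close>

lemma (in prob_space) integrable_AE_bounded:
  fixes X :: "'a \<Rightarrow> real"
  assumes "random_variable borel X" "AE x in M. \<bar>X x\<bar> \<le> B"
  shows "integrable M X"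
  using assms by (intro integrable_const_bound[of _ B]) auto

lemma (in prob_space) integrable_mult_AE_bounded:
  fixes X Y :: "'a \<Rightarrow> real"
  assumes [measurable]: "random_variable borel X" "random_variable borel Y"
    and "AE x in M. \<bar>X x\<bar> \<le> B" "AE x in M. \<bar>Y x\<bar> \<le> C"
  shows "integrable M (\<lambda>x. X x * Y x)"
proof (rule integrable_AE_bounded)
  show "AE x in M. \<bar>X x * Y x\<bar> \<le> B * C"
    using assms(3,4) by eventually_elim (auto simp: abs_mult intro!: mult_mono order_trans[OF abs_ge_zero])
qed simp

lemma (in prob_space) expectation_abs_AE_bounded:
  fixes X :: "'a \<Rightarrow> real"
  assumes "random_variable borel X" "AE x in M. \<bar>X x\<bar> \<le> B"
  shows "\<bar>expectation X\<bar> \<le> B"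
proof -
  have int: "integrable M X" by (rule integrable_AE_bounded[OF assms])
  have "\<bar>expectation X\<bar> \<le> expectation (\<lambda>x. \<bar>X x\<bar>)" by (rule integral_abs_bound)
  also have "\<dots> \<le> expectation (\<lambda>x. B)" using int assms by (intro integral_mono_AE) auto
  finally show ?thesis by (simp add: prob_space)
qed

lemma (in prob_space) expectation_abs_le_sqrt:
  fixes X :: "'a \<Rightarrow> real"
  assumes "integrable M X" "integrable M (\<lambda>x. (X x)\<^sup>2)"
  shows "expectation (\<lambda>x. \<bar>X x\<bar>) \<le> sqrt (expectation (\<lambda>x. (X x)\<^sup>2))"
proof -
  have "0 \<le> variance (\<lambda>x. \<bar>X x\<bar>)" by (rule variance_positive)
  also have "\<dots> = expectation (\<lambda>x. (X x)\<^sup>2) - (expectation (\<lambda>x. \<bar>X x\<bar>))\<^sup>2"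
    using assms by (subst variance_eq) auto
  finally show ?thesis by (intro real_le_rsqrt) simp
qed

text \<open>Z' has covariance 0 with X, so only the difference Z - Z' counts, and it vanishes off A.
  There it is at most 2 b, and the centred X is at most 2 a, which gives 4 a b. With A the event of
  no win in a gap this is the source of every geometric bound below.\<close>

lemma (in prob_space) covariance_approx_indep:
  fixes X Z Z' :: "'a \<Rightarrow> real"
  assumes [measurable]: "random_variable borel X" "random_variable borel Z" "random_variable borel Z'"
    and X: "AE x in M. \<bar>X x\<bar> \<le> a" and Z: "AE x in M. \<bar>Z x\<bar> \<le> b" and Z': "AE x in M. \<bar>Z' x\<bar> \<le> b"
    and indep: "indep_var borel X borel Z'"
    and A[measurable]: "A \<in> events" and prob: "prob A \<le> \<epsilon>"
    and eq: "AE x in M. x \<notin> A \<longrightarrow> Z x = Z' x"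
  shows "\<bar>covariance M X Z\<bar> \<le> 4 * a * b * \<epsilon>"
proof -
  have "a \<ge> 0" "b \<ge> 0"
  proof -
    have "AE x in M. 0 \<le> a" using X by eventually_elim linarith
    then show "a \<ge> 0" by simp
    have "AE x in M. 0 \<le> b" using Z by eventually_elim linarith
    then show "b \<ge> 0" by simp
  qed
  let ?m = "expectation X"
  have m: "\<bar>?m\<bar> \<le> a" using X by (intro expectation_abs_AE_bounded) auto
  \<comment> \<open>Centring X alone is enough: the mean of Z is multiplied by the mean of
    \<open>X0\<close>, which is 0.\<close>
  define X0 where "X0 = (\<lambda>x. X x - ?m)"
  have [measurable]: "random_variable borel X0" by (simp add: X0_def)
  have X0: "AE x in M. \<bar>X0 x\<bar> \<le> 2 * a"
    using X by eventually_elim (use m in \<open>auto simp: X0_def\<close>)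
  have int: "integrable M X" "integrable M Z'" "integrable M X0"
    using X Z' X0 by (auto intro: integrable_AE_bounded)
  have EX0: "expectation X0 = 0"
    unfolding X0_def using int by (simp add: prob_space)
  have i1: "integrable M (\<lambda>x. X0 x * Z x)" "integrable M (\<lambda>x. X0 x * Z' x)" "integrable M (\<lambda>x. X x * Z' x)"
    using X X0 Z Z' by (auto intro: integrable_mult_AE_bounded)
  have "expectation (\<lambda>x. X0 x * Z' x) = expectation (\<lambda>x. X x * Z' x) - ?m * expectation Z'"
    unfolding X0_def left_diff_distrib using int i1 by simp
  also have "\<dots> = 0"
    using indep_var_lebesgue_integral[OF indep int(1,2)] by simp
  finally have 0: "expectation (\<lambda>x. X0 x * Z' x) = 0" .
  have "covariance M X Z = expectation (\<lambda>x. X0 x * Z x - X0 x * expectation Z)"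
    unfolding covariance_def X0_def by (simp add: algebra_simps)
  also have "\<dots> = expectation (\<lambda>x. X0 x * Z x) - expectation (\<lambda>x. X0 x * Z' x)"
    using i1 int EX0 0 by simp
  also have "\<dots> = expectation (\<lambda>x. X0 x * Z x - X0 x * Z' x)"
    using i1 by simp
  also have "\<bar>\<dots>\<bar> \<le> expectation (\<lambda>x. \<bar>X0 x * Z x - X0 x * Z' x\<bar>)"
    by (rule integral_abs_bound)
  also have "\<dots> \<le> expectation (\<lambda>x. 4 * a * b * indicator A x)"
  proof (rule integral_mono_AE)
    show "integrable M (\<lambda>x. \<bar>X0 x * Z x - X0 x * Z' x\<bar>)" using i1 by auto
    show "integrable M (\<lambda>x. 4 * a * b * indicator A x)"
      by (intro integrable_mult_right integrable_AE_bounded[where B = 1]) (auto split: split_indicator)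
    show "AE x in M. \<bar>X0 x * Z x - X0 x * Z' x\<bar> \<le> 4 * a * b * indicator A x"
      using X0 Z Z' eq
    proof eventually_elim
      case (elim x)
      have "\<bar>X0 x * (Z x - Z' x)\<bar> \<le> (2 * a) * (2 * b)"
        unfolding abs_mult using elim \<open>a \<ge> 0\<close> by (intro mult_mono) auto
      then show ?case using elim(4) by (cases "x \<in> A") (auto simp: right_diff_distrib)
    qed
  qed
  also have "\<dots> = 4 * a * b * prob A" by simp
  also have "\<dots> \<le> 4 * a * b * \<epsilon>"
    using prob \<open>a \<ge> 0\<close> \<open>b \<ge> 0\<close> by (intro mult_left_mono) auto
  finally show ?thesis .
qed

lemma (in prob_space) expectation_sum_square_Suc:
  fixes Y :: "nat \<Rightarrow> 'a \<Rightarrow> real"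
  assumes int: "\<And>i j. integrable M (\<lambda>x. Y i x * Y j x)"
  shows "expectation (\<lambda>x. (\<Sum>i<Suc m. Y i x)\<^sup>2) = expectation (\<lambda>x. (\<Sum>i<m. Y i x)\<^sup>2)
    + expectation (\<lambda>x. (Y m x)\<^sup>2) + 2 * (\<Sum>i<m. expectation (\<lambda>x. Y i x * Y m x))"
proof -
  \<comment> \<open>Everything is expanded into products of two variables, since \<open>int\<close>
    gives integrability for these.\<close>
  have "(\<lambda>x. (\<Sum>i<Suc m. Y i x)\<^sup>2) =
      (\<lambda>x. (\<Sum>i<m. \<Sum>j<m. Y i x * Y j x) + Y m x * Y m x + 2 * (\<Sum>i<m. Y i x * Y m x))"
  proof
    fix x
    have "(\<Sum>i<Suc m. Y i x)\<^sup>2 = (\<Sum>i<m. Y i x)\<^sup>2 + (Y m x)\<^sup>2 + 2 * (\<Sum>i<m. Y i x) * Y m x"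
      by (simp add: power2_sum)
    then show "(\<Sum>i<Suc m. Y i x)\<^sup>2 =
        (\<Sum>i<m. \<Sum>j<m. Y i x * Y j x) + Y m x * Y m x + 2 * (\<Sum>i<m. Y i x * Y m x)"
      unfolding power2_eq_square sum_product sum_distrib_right[symmetric] by (simp add: mult.assoc)
  qed
  then show ?thesis
    using int by (simp add: power2_eq_square sum_product)
qed

lemma sum_power_rev_le:
  fixes \<rho> :: real
  assumes "0 \<le> \<rho>" "\<rho> < 1"
  shows "(\<Sum>i<m. \<rho> ^ (m - Suc i)) \<le> 1 / (1 - \<rho>)"
proof -
  have "(\<Sum>i<m. \<rho> ^ (m - Suc i)) = (\<Sum>i<m. \<rho> ^ i)" by (rule sum.nat_diff_reindex)
  also have "\<dots> \<le> (\<Sum>i. \<rho> ^ i)"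
    using assms by (intro sum_le_suminf summable_geometric) auto
  also have "\<dots> = 1 / (1 - \<rho>)" using assms by (intro suminf_geometric) auto
  finally show ?thesis .
qed

text \<open>Adding one more variable adds its second moment and twice its products with all earlier
  ones, at most K + 2 K / (1 - \<rho>) by the geometric series.\<close>

lemma (in prob_space) expectation_sum_square_le:
  fixes Y :: "nat \<Rightarrow> 'a \<Rightarrow> real"
  assumes int: "\<And>i j. integrable M (\<lambda>x. Y i x * Y j x)"
    and diag: "\<And>i. expectation (\<lambda>x. (Y i x)\<^sup>2) \<le> K"
    and off: "\<And>i j. i < j \<Longrightarrow> \<bar>expectation (\<lambda>x. Y i x * Y j x)\<bar> \<le> K * \<rho> ^ (j - Suc i)"
    and K: "K \<ge> 0" and \<rho>: "0 \<le> \<rho>" "\<rho> < 1"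
  shows "expectation (\<lambda>x. (\<Sum>i<m. Y i x)\<^sup>2) \<le> real m * (K * (1 + 2 / (1 - \<rho>)))"
proof (induction m)
  case (Suc m)
  have "(\<Sum>i<m. expectation (\<lambda>x. Y i x * Y m x)) \<le> (\<Sum>i<m. K * \<rho> ^ (m - Suc i))"
    using off by (intro sum_mono) (meson abs_le_D1 lessThan_iff)
  also have "\<dots> = K * (\<Sum>i<m. \<rho> ^ (m - Suc i))" by (simp add: sum_distrib_left)
  also have "\<dots> \<le> K * (1 / (1 - \<rho>))"
    using K by (intro mult_left_mono sum_power_rev_le \<rho>)
  finally have "(\<Sum>i<m. expectation (\<lambda>x. Y i x * Y m x)) \<le> K * (1 / (1 - \<rho>))" .
  moreover have "real (Suc m) * (K * (1 + 2 / (1 - \<rho>)))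
      = real m * (K * (1 + 2 / (1 - \<rho>))) + K + 2 * (K * (1 / (1 - \<rho>)))"
    by (simp add: distrib_left distrib_right add_divide_distrib)
  ultimately show ?case
    using Suc diag[of m] unfolding expectation_sum_square_Suc[OF int] by linarith
qed simp

text \<open>Passing from m to m + 1 variables adds \<gamma> 0 plus twice a partial sum of the
  covariance series. This misses the limiting increment by at most
  \<open>2 * K * \<rho> ^ m / (1 - \<rho>)\<close>, and the misses are summable over m, so the total
  error stays bounded.\<close>

lemma (in prob_space) expectation_sum_square_stationary:
  fixes Y :: "nat \<Rightarrow> 'a \<Rightarrow> real" and \<gamma> :: "nat \<Rightarrow> real"
  assumes int: "\<And>i j. integrable M (\<lambda>x. Y i x * Y j x)"
    and \<gamma>: "\<And>i j. i \<le> j \<Longrightarrow> expectation (\<lambda>x. Y i x * Y j x) = \<gamma> (j - i)"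
    and bound: "\<And>h. \<bar>\<gamma> (Suc h)\<bar> \<le> K * \<rho> ^ h"
    and \<rho>: "0 \<le> \<rho>" "\<rho> < 1"
  shows "\<bar>expectation (\<lambda>x. (\<Sum>i<m. Y i x)\<^sup>2) - real m * (\<gamma> 0 + 2 * (\<Sum>h. \<gamma> (Suc h)))\<bar>
    \<le> 2 * K / (1 - \<rho>)\<^sup>2"
proof -
  have geo: "summable (\<lambda>h. \<rho> ^ h)" using \<rho> by (intro summable_geometric) auto
  have sum: "summable (\<lambda>h. \<gamma> (Suc h))"
    using geo bound by (intro summable_comparison_test[OF _ summable_mult[OF geo, of K]]) auto
  have K: "K \<ge> 0" using order_trans[OF abs_ge_zero bound[of 0]] by simp
  let ?s = "\<gamma> 0 + 2 * (\<Sum>h. \<gamma> (Suc h))"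
  have "\<bar>expectation (\<lambda>x. (\<Sum>i<m. Y i x)\<^sup>2) - real m * ?s\<bar> \<le> (\<Sum>i<m. 2 * K / (1 - \<rho>) * \<rho> ^ i)"
  proof (induction m)
    case (Suc m)
    have "(\<Sum>i<m. expectation (\<lambda>x. Y i x * Y m x)) = (\<Sum>i<m. \<gamma> (Suc (m - Suc i)))"
      by (intro sum.cong refl) (auto simp: \<gamma> Suc_diff_Suc)
    also have "\<dots> = (\<Sum>h<m. \<gamma> (Suc h))" by (rule sum.nat_diff_reindex)
    finally have eq: "expectation (\<lambda>x. (\<Sum>i<Suc m. Y i x)\<^sup>2) = expectation (\<lambda>x. (\<Sum>i<m. Y i x)\<^sup>2)
        + \<gamma> 0 + 2 * (\<Sum>h<m. \<gamma> (Suc h))"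
      using \<gamma>[of m m] unfolding expectation_sum_square_Suc[OF int] by (simp add: power2_eq_square)
    have "(\<Sum>h. \<gamma> (Suc h)) - (\<Sum>h<m. \<gamma> (Suc h)) = (\<Sum>h. \<gamma> (Suc (h + m)))"
      using suminf_split_initial_segment[OF sum, of m] by simp
    also have "\<bar>\<dots>\<bar> \<le> (\<Sum>h. K * \<rho> ^ m * \<rho> ^ h)"
    proof -
      have s2: "summable (\<lambda>h. K * \<rho> ^ m * \<rho> ^ h)" by (intro summable_mult geo)
      have le: "\<bar>\<gamma> (Suc (h + m))\<bar> \<le> K * \<rho> ^ m * \<rho> ^ h" for h
        using bound[of "h + m"] by (simp add: power_add mult_ac)
      have s1: "summable (\<lambda>h. \<bar>\<gamma> (Suc (h + m))\<bar>)"
        using le by (intro summable_comparison_test[OF _ s2]) auto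
      show ?thesis
        using summable_rabs[OF s1] suminf_le[OF le s1 s2] by linarith
    qed
    also have "\<dots> = K * \<rho> ^ m * (1 / (1 - \<rho>))"
      using \<rho> by (subst suminf_mult[OF geo]) (simp add: suminf_geometric)
    finally have "\<bar>(\<Sum>h. \<gamma> (Suc h)) - (\<Sum>h<m. \<gamma> (Suc h))\<bar> \<le> K * \<rho> ^ m * (1 / (1 - \<rho>))" .
    moreover have "real (Suc m) * ?s = real m * ?s + ?s" by (simp add: distrib_right)
    moreover have "(\<Sum>i<Suc m. 2 * K / (1 - \<rho>) * \<rho> ^ i) =
        (\<Sum>i<m. 2 * K / (1 - \<rho>) * \<rho> ^ i) + 2 * (K * \<rho> ^ m * (1 / (1 - \<rho>)))"
      by simp
    ultimately show ?case using Suc unfolding eq by linarith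
  qed simp
  also have "\<dots> = 2 * K / (1 - \<rho>) * (\<Sum>i<m. \<rho> ^ i)" by (simp add: sum_distrib_left)
  also have "\<dots> \<le> 2 * K / (1 - \<rho>) * (\<Sum>i. \<rho> ^ i)"
    using \<rho> K by (intro mult_left_mono sum_le_suminf geo) auto
  also have "\<dots> = 2 * K / (1 - \<rho>)\<^sup>2"
    using \<rho> by (simp add: suminf_geometric power2_eq_square)
  finally show ?thesis .
qed

text \<open>Young's inequality \<open>2 y e \<le> \<delta> y\<^sup>2 + e\<^sup>2 / \<delta>\<close> for the centred cross term.\<close>
lemma (in prob_space) variance_perturbation:
  fixes X Y :: "'a \<Rightarrow> real"
  assumes [measurable]: "random_variable borel X" "random_variable borel Y"
    and X: "AE x in M. \<bar>X x\<bar> \<le> B" and Y: "AE x in M. \<bar>Y x\<bar> \<le> B"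
    and diff: "AE x in M. \<bar>X x - Y x\<bar> \<le> C" and \<delta>: "\<delta> > 0"
  shows "\<bar>variance X - variance Y\<bar> \<le> \<delta> * variance Y + (1 + 1 / \<delta>) * (2 * C)\<^sup>2"
proof -
  define y where "y = (\<lambda>x. Y x - expectation Y)"
  \<comment> \<open>The centred difference is at most 2 C: one C from X - Y and one from the
    difference of the means.\<close>
  define e where "e = (\<lambda>x. (X x - expectation X) - (Y x - expectation Y))"
  have iX: "integrable M X" and iY: "integrable M Y" using X Y by (auto intro: integrable_AE_bounded)
  have [measurable]: "random_variable borel y" "random_variable borel e"
    by (simp_all add: y_def e_def)
  have "\<bar>expectation (\<lambda>x. X x - Y x)\<bar> \<le> C"
    using diff by (intro expectation_abs_AE_bounded) auto
  then have E: "\<bar>expectation X - expectation Y\<bar> \<le> C" using iX iY by simp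
  have e_bound: "AE x in M. \<bar>e x\<bar> \<le> 2 * C"
    using diff by eventually_elim (use E in \<open>simp add: e_def\<close>)
  have "\<bar>expectation Y\<bar> \<le> B" using Y by (intro expectation_abs_AE_bounded) auto
  then have y_bound: "AE x in M. \<bar>y x\<bar> \<le> 2 * B"
    using Y by (auto simp: y_def elim!: eventually_mono)
  have i: "integrable M (\<lambda>x. y x * y x)" "integrable M (\<lambda>x. y x * e x)" "integrable M (\<lambda>x. e x * e x)"
    using y_bound e_bound by (auto intro: integrable_mult_AE_bounded)
  have "variance X = expectation (\<lambda>x. y x * y x + 2 * (y x * e x) + e x * e x)"
    by (rule Bochner_Integration.integral_cong) (auto simp: y_def e_def power2_eq_square algebra_simps)
  also have "\<dots> = variance Y + expectation (\<lambda>x. 2 * (y x * e x) + e x * e x)"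
    using i by (simp add: y_def power2_eq_square)
  finally have "\<bar>variance X - variance Y\<bar> = \<bar>expectation (\<lambda>x. 2 * (y x * e x) + e x * e x)\<bar>"
    by simp
  also have "\<dots> \<le> expectation (\<lambda>x. \<bar>2 * (y x * e x) + e x * e x\<bar>)" by (rule integral_abs_bound)
  also have "\<dots> \<le> expectation (\<lambda>x. \<delta> * (y x * y x) + (1 + 1 / \<delta>) * (2 * C)\<^sup>2)"
  proof (rule integral_mono_AE)
    show "AE x in M. \<bar>2 * (y x * e x) + e x * e x\<bar> \<le> \<delta> * (y x * y x) + (1 + 1 / \<delta>) * (2 * C)\<^sup>2"
      using e_bound
    proof eventually_elim
      case (elim x)
      have e2: "e x * e x \<le> (2 * C)\<^sup>2"
        using elim abs_le_square_iff[of "e x" "2 * C"] by (simp add: power2_eq_square)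
      have "0 \<le> (\<delta> * \<bar>y x\<bar> - \<bar>e x\<bar>)\<^sup>2 / \<delta>" using \<delta> by simp
      also have "\<dots> = \<delta> * (y x * y x) - 2 * \<bar>y x * e x\<bar> + (e x * e x) / \<delta>"
        using \<delta> by (simp add: power2_diff abs_mult power2_eq_square field_simps)
      also have "(e x * e x) / \<delta> \<le> (2 * C)\<^sup>2 / \<delta>" using e2 \<delta> by (simp add: divide_right_mono)
      finally have "2 * \<bar>y x * e x\<bar> \<le> \<delta> * (y x * y x) + (2 * C)\<^sup>2 / \<delta>" by simp
      moreover have "\<bar>2 * (y x * e x) + e x * e x\<bar> \<le> 2 * \<bar>y x * e x\<bar> + e x * e x"
        using abs_triangle_ineq[of "2 * (y x * e x)" "e x * e x"] by (simp add: abs_mult)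
      ultimately show ?case using e2 by (simp add: algebra_simps)
    qed
  qed (use i in auto)
  also have "\<dots> = \<delta> * variance Y + (1 + 1 / \<delta>) * (2 * C)\<^sup>2"
    using i by (simp add: y_def power2_eq_square prob_space)
  finally show ?thesis .
qed

section \<open>Measurability of the payouts\<close>

text \<open>Measurability is asked only of the coordinates that are read, here and in the lemmas
  that follow, so that they also apply on product spaces indexed by a window of times.\<close>

lemma measurable_pointer:
  "(\<And>k. k \<in> {1..n} \<Longrightarrow> (\<lambda>x. s x k) \<in> borel_measurable M) \<Longrightarrow>
    (\<lambda>x. pointer J j (s x) n) \<in> measurable M (count_space UNIV)"
proof (induction n)
  case (Suc n)
  have [measurable]: "(\<lambda>x. s x (Suc n)) \<in> borel_measurable M" using Suc.prems by simp
  have [measurable]: "(\<lambda>x. pointer J j (s x) n) \<in> measurable M (count_space UNIV)"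
    using Suc by simp
  show ?case unfolding pointer.simps by measurable
qed simp

lemma measurable_payout_sum:
  assumes "\<And>k. k \<in> {1..n} \<Longrightarrow> (\<lambda>x. s x k) \<in> borel_measurable M"
  shows "(\<lambda>x. payout_sum J j (s x) n) \<in> borel_measurable M"
  unfolding payout_sum_def
proof (rule borel_measurable_sum)
  fix k assume k: "k \<in> {1..n}"
  have [measurable]: "(\<lambda>x. s x k) \<in> borel_measurable M" using assms k by simp
  have [measurable]: "(\<lambda>x. pointer J j (s x) (k - 1)) \<in> measurable M (count_space UNIV)"
    using assms k by (intro measurable_pointer) auto
  show "(\<lambda>x. futurity_payout J j (s x) k) \<in> borel_measurable M"
    unfolding futurity_payout_def by measurable
qed

lemma measurable_fresh_sum:
  assumes "\<And>k. k \<in> {b+1..b+int n} \<Longrightarrow> (\<lambda>x. r x k) \<in> borel_measurable M"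
  shows "(\<lambda>x. fresh_sum J (r x) b n) \<in> borel_measurable M"
  unfolding fresh_sum_def
  by (intro measurable_payout_sum) (auto simp: payouts_after_def intro!: assms)

lemma measurable_carry:
  assumes "\<And>k. k \<in> {b+1..b+int m+int n} \<Longrightarrow> (\<lambda>x. r x k) \<in> borel_measurable M"
  shows "(\<lambda>x. carry J (r x) b m n) \<in> borel_measurable M"
  unfolding carry_def
  by (intro borel_measurable_diff measurable_fresh_sum assms) auto

lemma measurable_stationary_payout:
  assumes "\<And>i. i \<le> n \<Longrightarrow> (\<lambda>x. r x i) \<in> borel_measurable M"
  shows "(\<lambda>x. stationary_payout J (r x) n) \<in> borel_measurable M"
proof -
  have [measurable]: "(\<lambda>x. r x (n - int k)) \<in> borel_measurable M" for k
    by (intro assms) simp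
  have [measurable]: "(\<lambda>x. r x n) \<in> borel_measurable M" by (intro assms) simp
  have [measurable]: "Measurable.pred M (\<lambda>x. \<forall>m\<in>{n - int ((k + 1) * J) + 1..n}. r x m = 0)" for k
  proof (rule pred_intros_finite)
    fix m assume "m \<in> {n - int ((k + 1) * J) + 1..n}"
    then have [measurable]: "(\<lambda>x. r x m) \<in> borel_measurable M" by (intro assms) simp
    show "Measurable.pred M (\<lambda>x. r x m = 0)" by measurable
  qed simp
  show ?thesis unfolding stationary_payout_def by measurable
qed

lemma measurable_cycle_payout:
  assumes "\<And>i. i \<le> (k + 1) * int I \<Longrightarrow> (\<lambda>x. r x i) \<in> borel_measurable M"
  shows "(\<lambda>x. cycle_payout J I (r x) k) \<in> borel_measurable M"
  unfolding cycle_payout_def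
  by (intro borel_measurable_sum measurable_stationary_payout assms) auto

section \<open>The stationary process\<close>

lemma (in prob_space) indep_vars_reindex:
  assumes indep: "indep_vars (\<lambda>_. S) X K" and f: "inj_on f L" "f ` L \<subseteq> K"
  shows "indep_vars (\<lambda>_. S) (\<lambda>j. X (f j)) L"
proof -
  \<comment> \<open>Injectivity makes the singletons {f j} disjoint groups of the family; projecting
    each group to its one coordinate gives the claim.\<close>
  have "indep_vars (\<lambda>j. PiM {f j} (\<lambda>_. S)) (\<lambda>j \<omega>. restrict (\<lambda>i. X i \<omega>) {f j}) L"
    using f by (intro indep_vars_restrict[OF indep]) (auto simp: disjoint_family_on_def inj_on_def)
  then have "indep_vars (\<lambda>_. S) (\<lambda>j \<omega>. (\<lambda>h. h (f j)) (restrict (\<lambda>i. X i \<omega>) {f j})) L"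
    by (rule indep_vars_compose2) simp
  then show ?thesis by simp
qed

lemma (in prob_space) indep_var_of_indep_vars:
  assumes indep: "indep_vars (\<lambda>_. S) X UNIV" and "i \<noteq> j"
  shows "indep_var S (X i) S (X j)"
proof -
  have "indep_vars (\<lambda>_. S) (\<lambda>b. X (case_bool i j b)) UNIV"
    using assms(2) by (intro indep_vars_reindex[OF indep]) (auto simp: inj_on_def split: bool.splits)
  moreover have "(\<lambda>b. X (case_bool i j b)) = case_bool (X i) (X j)" "(\<lambda>_. S) = case_bool S S"
    by (auto simp: fun_eq_iff split: bool.split)
  ultimately show ?thesis by (simp add: indep_var_def)
qed

text \<open>An independent family has the product of its marginals as joint law, so equal marginals
  give equal laws of every measurable functional, even over different probability spaces.\<close>

lemma distr_indep_functional_eq: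
  fixes X :: "'i \<Rightarrow> 'a \<Rightarrow> real" and Y :: "'i \<Rightarrow> 'b \<Rightarrow> real"
  assumes M: "prob_space M" and N: "prob_space N" and K: "K \<noteq> {}"
    and X: "prob_space.indep_vars M (\<lambda>_. borel) X K" and Y: "prob_space.indep_vars N (\<lambda>_. borel) Y K"
    and eq: "\<And>i. i \<in> K \<Longrightarrow> distr M borel (X i) = distr N borel (Y i)"
    and f: "f \<in> borel_measurable (PiM K (\<lambda>_. borel))"
  shows "distr M borel (\<lambda>x. f (\<lambda>i\<in>K. X i x)) = distr N borel (\<lambda>x. f (\<lambda>i\<in>K. Y i x))"
proof -
  interpret M: prob_space M by fact
  interpret N: prob_space N by fact
  have X': "i \<in> K \<Longrightarrow> X i \<in> borel_measurable M" and Y': "i \<in> K \<Longrightarrow> Y i \<in> borel_measurable N" for i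
    using X Y by (auto simp: M.indep_vars_def N.indep_vars_def)
  have "distr M (PiM K (\<lambda>_. borel)) (\<lambda>x. \<lambda>i\<in>K. X i x) = PiM K (\<lambda>i. distr M borel (X i))"
    using X by (subst (asm) M.indep_vars_iff_distr_eq_PiM'[OF K X'])
  also have "\<dots> = PiM K (\<lambda>i. distr N borel (Y i))"
    by (intro PiM_cong refl eq)
  also have "\<dots> = distr N (PiM K (\<lambda>_. borel)) (\<lambda>x. \<lambda>i\<in>K. Y i x)"
    using Y by (subst (asm) N.indep_vars_iff_distr_eq_PiM'[OF K Y']) simp_all
  finally have "distr (distr M (PiM K (\<lambda>_. borel)) (\<lambda>x. \<lambda>i\<in>K. X i x)) borel f =
      distr (distr N (PiM K (\<lambda>_. borel)) (\<lambda>x. \<lambda>i\<in>K. Y i x)) borel f"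
    by simp
  then show ?thesis
    using f X' Y' by (simp add: distr_distr measurable_restrict comp_def)
qed

text \<open>Condenses the finitely many payout distributions into one bound B, one bound q < 1 on
  the probability of a loss, and periodicity of the marginals. The powers of q are the rate at which
  dependence dies out.\<close>

locale payout_process = prob_space N for N :: "'b measure" +
  fixes R :: "int \<Rightarrow> 'b \<Rightarrow> real" and J I :: nat and B q :: real
  assumes J: "J \<ge> 2" and I: "I \<ge> 1"
    and indep: "indep_vars (\<lambda>_. borel) R UNIV"
    and periodic: "\<And>n. distr N borel (R (n + int I)) = distr N borel (R n)"
    and bounded: "\<And>n. AE x in N. 0 \<le> R n x \<and> R n x \<le> B"
    and loss: "\<And>n. prob {x \<in> space N. R n x = 0} \<le> q" and q: "q < 1"
begin

abbreviation path :: "'b \<Rightarrow> int \<Rightarrow> real" where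
  "path x \<equiv> (\<lambda>n. R n x)"

lemma rv [measurable]: "R n \<in> borel_measurable N"
  using indep by (simp add: indep_vars_def)

lemma q_nonneg: "0 \<le> q"
  using loss[of 0] measure_nonneg order_trans by blast

lemma prob_no_win: "prob {x \<in> space N. \<forall>k\<in>{b+1..b+int m}. R k x = 0} \<le> q ^ m"
proof (cases "m = 0")
  case False
  have "{x \<in> space N. \<forall>k\<in>{b+1..b+int m}. R k x = 0} = (\<Inter>k\<in>{b+1..b+int m}. R k -` {0} \<inter> space N)"
    using False by auto
  also have "prob \<dots> = (\<Prod>k\<in>{b+1..b+int m}. prob (R k -` {0} \<inter> space N))"
    using False by (intro indep_varsD[OF indep]) auto
  also have "\<dots> \<le> (\<Prod>k\<in>{b+1..b+int m}. q)"
  proof (intro prod_mono conjI)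
    fix k
    have "R k -` {0} \<inter> space N = {x \<in> space N. R k x = 0}" by auto
    then show "prob (R k -` {0} \<inter> space N) \<le> q" using loss by simp
  qed simp
  also have "\<dots> = q ^ m" by simp
  finally show ?thesis .
qed simp

lemma AE_bounds: "AE x in N. \<forall>n. 0 \<le> R n x \<and> R n x \<le> B"
  using bounded by (subst AE_all_countable) blast

text \<open>The absence of any win up to b has probability at most \<open>q ^ m\<close> for every m.
  There are countably many b, so a single null set serves for all; off it every time has an earlier
  win to anchor the streak.\<close>

lemma AE_win: "AE x in N. \<forall>b. \<exists>a\<le>b. R a x \<noteq> 0"
proof (subst AE_all_countable, rule allI)
  fix b
  let ?A = "{x \<in> space N. \<forall>a. a \<le> b \<longrightarrow> R a x = 0}"
  have A[measurable]: "?A \<in> events" by measurable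
  have "prob ?A \<le> q ^ m" for m
  proof -
    have "prob ?A \<le> prob {x \<in> space N. \<forall>k\<in>{(b - int m)+1..(b - int m)+int m}. R k x = 0}"
      by (rule finite_measure_mono) (auto, measurable)
    also have "\<dots> \<le> q ^ m" by (rule prob_no_win)
    finally show ?thesis .
  qed
  moreover have "(\<lambda>m. q ^ m) \<longlonglongrightarrow> 0"
    using q q_nonneg by (intro LIMSEQ_power_zero) auto
  ultimately have "prob ?A \<le> 0"
    by (intro LIMSEQ_le_const) auto
  then have "prob ?A = 0" using measure_nonneg[of N ?A] by linarith
  then have "AE x in N. x \<notin> ?A" using prob_eq_0[OF A] by simp
  then show "AE x in N. \<exists>a\<le>b. R a x \<noteq> 0"
    by (auto elim!: AE_mp)
qed

lemma B_nonneg: "0 \<le> B"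
proof -
  have "AE x in N. 0 \<le> B" using bounded[of 0] by eventually_elim linarith
  then show ?thesis by simp
qed

lemma fresh_sum_AE_bounds:
  "AE x in N. \<forall>b n. 0 \<le> fresh_sum J (path x) b n \<and> fresh_sum J (path x) b n \<le> n * (B + J)"
  using AE_bounds by eventually_elim (auto intro!: fresh_sum_bounds[THEN conjunct1] fresh_sum_bounds[THEN conjunct2])

text \<open>The last bound is uniform in n: inherited and reset pointers are two initial values of
  one machine.\<close>

lemma stationary_sum_AE:
  "AE x in N. \<forall>b n. 0 \<le> (\<Sum>i\<in>{b+1..b+int n}. stationary_payout J (path x) i) \<and>
     (\<Sum>i\<in>{b+1..b+int n}. stationary_payout J (path x) i) \<le> n * (B + J) \<and>
     \<bar>(\<Sum>i\<in>{b+1..b+int n}. stationary_payout J (path x) i) - fresh_sum J (path x) b n\<bar> \<le> J"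
  using AE_bounds AE_win
proof eventually_elim
  case (elim x)
  show ?case
  proof (intro allI)
    fix b n
    from elim(2) obtain a where a: "a \<le> b" "R a x \<noteq> 0" by blast
    define j where "j = pointer J 0 (payouts_after a (path x)) (nat (b - a))"
    have j: "j < J" unfolding j_def using J by (intro pointer_less) auto
    have eq: "(\<Sum>i\<in>{b+1..b+int n}. stationary_payout J (path x) i) = payout_sum J j (payouts_after b (path x)) n"
      unfolding j_def using a elim J by (intro sum_stationary_payout) auto
    have "0 \<le> payout_sum J j (payouts_after b (path x)) n \<and>
        payout_sum J j (payouts_after b (path x)) n \<le> n * (B + J)"
      using elim(1) by (intro payout_sum_bounds) (auto simp: payouts_after_def)
    moreover have "\<bar>payout_sum J j (payouts_after b (path x)) n - fresh_sum J (path x) b n\<bar> \<le> J"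
      unfolding fresh_sum_def using J j by (intro payout_sum_diff) auto
    ultimately show "0 \<le> (\<Sum>i\<in>{b+1..b+int n}. stationary_payout J (path x) i) \<and>
     (\<Sum>i\<in>{b+1..b+int n}. stationary_payout J (path x) i) \<le> n * (B + J) \<and>
     \<bar>(\<Sum>i\<in>{b+1..b+int n}. stationary_payout J (path x) i) - fresh_sum J (path x) b n\<bar> \<le> J"
      unfolding eq by blast
  qed
qed

lemma indep_functionals:
  assumes "f \<in> borel_measurable (PiM A (\<lambda>_. borel))" "g \<in> borel_measurable (PiM C (\<lambda>_. borel))" "A \<inter> C = {}"
  shows "indep_var borel (\<lambda>x. f (restrict (path x) A)) borel (\<lambda>x. g (restrict (path x) C))"
  using indep_var_compose[OF indep_var_restrict[OF indep assms(3)] assms(1,2)] by (simp add: comp_def)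

lemma distr_path:
  "distr N (PiM UNIV (\<lambda>_. borel)) (\<lambda>x n. R (n + c) x) = PiM UNIV (\<lambda>n. distr N borel (R (n + c)))"
proof -
  have "indep_vars (\<lambda>_. borel) (\<lambda>n. R (n + c)) UNIV"
    by (rule indep_vars_reindex[OF indep]) (auto simp: inj_on_def)
  then show ?thesis
    by (subst (asm) indep_vars_iff_distr_eq_PiM') (auto simp: restrict_UNIV)
qed

text \<open>Stationarity under shifts by whole periods. The joint law is the product of the
  marginals, and these return after I steps.\<close>

lemma distr_shift:
  assumes f: "f \<in> borel_measurable (PiM UNIV (\<lambda>_. borel))"
  shows "distr N borel (\<lambda>x. f (\<lambda>n. R (n + int k * int I) x)) = distr N borel (\<lambda>x. f (path x))"
proof -
  have per: "distr N borel (R (n + int k * int I)) = distr N borel (R n)" for n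
  proof (induction k)
    case (Suc k)
    then show ?case using periodic[of "n + int k * int I"] by (simp add: algebra_simps)
  qed simp
  have m: "(\<lambda>x n. R (n + c) x) \<in> measurable N (PiM UNIV (\<lambda>_. borel))" for c
    by (rule measurable_PiM_single') auto
  have "distr N borel (\<lambda>x. f (\<lambda>n. R (n + int k * int I) x)) =
      distr (distr N (PiM UNIV (\<lambda>_. borel)) (\<lambda>x n. R (n + int k * int I) x)) borel f"
    using m f by (subst distr_distr) (auto simp: comp_def)
  also have "\<dots> = distr (distr N (PiM UNIV (\<lambda>_. borel)) (\<lambda>x n. R (n + 0) x)) borel f"
    unfolding distr_path per by simp
  also have "\<dots> = distr N borel (\<lambda>x. f (\<lambda>n. R (n + 0) x))"
    using m[of 0] f by (subst distr_distr) (auto simp: comp_def)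
  finally show ?thesis by simp
qed

lemma expectation_shift:
  assumes f: "f \<in> borel_measurable (PiM UNIV (\<lambda>_. borel))"
  shows "expectation (\<lambda>x. f (\<lambda>n. R (n + int k * int I) x)) = (expectation (\<lambda>x. f (path x)) :: real)"
proof -
  have m: "(\<lambda>x n. R (n + c) x) \<in> measurable N (PiM UNIV (\<lambda>_. borel))" for c
    by (rule measurable_PiM_single') auto
  note [measurable] = measurable_compose[OF m f] measurable_compose[OF m[of 0, simplified] f]
  have "expectation (\<lambda>x. f (\<lambda>n. R (n + int k * int I) x))
      = (\<integral>y. y \<partial>distr N borel (\<lambda>x. f (\<lambda>n. R (n + int k * int I) x)))"
    by (subst integral_distr) auto
  also have "\<dots> = (\<integral>y. y \<partial>distr N borel (\<lambda>x. f (path x)))" by (simp only: distr_shift[OF f])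
  also have "\<dots> = expectation (\<lambda>x. f (path x))" by (subst integral_distr) auto
  finally show ?thesis .
qed

section \<open>Second moments of the cycle payouts\<close>

abbreviation cycle :: "nat \<Rightarrow> 'b \<Rightarrow> real" where
  "cycle k x \<equiv> cycle_payout J I (path x) (int k)"

lemma cycle_rv [measurable]: "cycle k \<in> borel_measurable N"
  by (intro measurable_cycle_payout) simp

lemma fresh_sum_rv [measurable]: "(\<lambda>x. fresh_sum J (path x) b n) \<in> borel_measurable N"
  by (intro measurable_fresh_sum) simp

lemma carry_rv [measurable]: "(\<lambda>x. carry J (path x) b m n) \<in> borel_measurable N"
  by (intro measurable_carry) simp

lemma cycle_bounds: "AE x in N. \<bar>cycle k x\<bar> \<le> I * (B + J)"
  using stationary_sum_AE
proof eventually_elim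
  case (elim x)
  then show ?case
    using elim[rule_format, of "int k * int I" I] by (simp add: cycle_payout_altdef)
qed

lemma cycle_shift: "cycle (k + c) x = cycle_payout J I (\<lambda>n. R (n + int c * int I) x) (int k)"
  using cycle_payout_shift[of J I "path x" "int k" "int c"] by simp

lemma measurable_cycle_PiM [measurable]:
  "(\<lambda>r. cycle_payout J I r k) \<in> borel_measurable (PiM UNIV (\<lambda>_. borel))"
  by (intro measurable_cycle_payout) simp

lemma expectation_cycle: "expectation (cycle k) = mu_bar J I N R"
  using expectation_shift[of "\<lambda>r. cycle_payout J I r 0" k] cycle_shift[where k = 0 and c = k]
  by (simp add: mu_bar_def)

lemma covariance_cycle:
  assumes "i \<le> j"
  shows "expectation (\<lambda>x. (cycle i x - mu_bar J I N R) * (cycle j x - mu_bar J I N R))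
    = covariance N (cycle 0) (cycle (j - i))"
proof -
  let ?f = "\<lambda>r. (cycle_payout J I r 0 - mu_bar J I N R) * (cycle_payout J I r (int (j - i)) - mu_bar J I N R)"
  have "expectation (\<lambda>x. (cycle i x - mu_bar J I N R) * (cycle j x - mu_bar J I N R))
     = expectation (\<lambda>x. ?f (\<lambda>n. R (n + int i * int I) x))"
    using cycle_shift[where k = 0 and c = i] cycle_shift[where k = "j - i" and c = i] assms by simp
  also have "\<dots> = expectation (\<lambda>x. ?f (path x))" by (rule expectation_shift) measurable
  also have "\<dots> = covariance N (cycle 0) (cycle (j - i))"
    unfolding covariance_def expectation_cycle by simp
  finally show ?thesis .
qed

text \<open>Cycle 0 is determined by the times up to I, and h * I coups lie between it and cycle h +
  1. A machine started with pointer 0 at time I pays in cycle h + 1 an amount independent of cycle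
  0, and a win in the gap makes it agree with the stationary machine.\<close>

lemma covariance_cycle_bound:
  "\<bar>covariance N (cycle 0) (cycle (Suc h))\<bar> \<le> 4 * (I * (B + J)) * (I * (B + J)) * q ^ h"
proof -
  \<comment> \<open>The payout of the restarted machine in cycle h + 1, written as a difference of
    two fresh sums so that their measurability and locality carry over.\<close>
  define Z' where "Z' = (\<lambda>r. fresh_sum J r I (h * I + I) - fresh_sum J r I (h * I))"
  define A where "A = {x \<in> space N. \<forall>k\<in>{int I+1..int I+int (h * I)}. R k x = 0}"
  have Z'_eq: "Z' r = payout_sum J (pointer J 0 (payouts_after (int I) r) (h * I)) (payouts_after (int I + int (h * I)) r) I" for r
    unfolding Z'_def by (simp add: fresh_sum_add)
  have ind: "indep_var borel (\<lambda>x. cycle_payout J I (restrict (path x) {..int I}) 0)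
      borel (\<lambda>x. Z' (restrict (path x) {int I+1..}))"
  proof (rule indep_functionals)
    show "(\<lambda>r. cycle_payout J I r 0) \<in> borel_measurable (PiM {..int I} (\<lambda>_. borel))"
      by (intro measurable_cycle_payout) simp
    show "Z' \<in> borel_measurable (PiM {int I+1..} (\<lambda>_. borel))"
      unfolding Z'_def by (intro borel_measurable_diff measurable_fresh_sum) auto
  qed auto
  have "cycle_payout J I (restrict (path x) {..int I}) 0 = cycle 0 x" for x
    unfolding of_nat_0 by (intro cycle_payout_cong) auto
  moreover have "Z' (restrict (path x) {int I+1..}) = Z' (path x)" for x
    unfolding Z'_def by (intro arg_cong2[of _ _ _ _ "(-)"] fresh_sum_cong) auto
  ultimately have ind': "indep_var borel (cycle 0) borel (\<lambda>x. Z' (path x))"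
    using ind by simp
  show ?thesis
  proof (rule covariance_approx_indep[OF _ _ _ cycle_bounds cycle_bounds _ ind'])
    show "random_variable borel (\<lambda>x. Z' (path x))" unfolding Z'_def by measurable
    show "AE x in N. \<bar>Z' (path x)\<bar> \<le> real I * (B + real J)"
      using AE_bounds
    proof eventually_elim
      case (elim x)
      then have "0 \<le> Z' (path x) \<and> Z' (path x) \<le> real I * (B + real J)"
        unfolding Z'_eq by (intro payout_sum_bounds) (auto simp: payouts_after_def)
      then show ?case by simp
    qed
    show "A \<in> events" unfolding A_def by measurable
    have "prob A \<le> q ^ (h * I)" unfolding A_def by (rule prob_no_win)
    also have "\<dots> \<le> q ^ h"
      using q q_nonneg I by (intro power_decreasing) auto
    finally show "prob A \<le> q ^ h" .
    show "AE x in N. x \<notin> A \<longrightarrow> cycle (Suc h) x = Z' (path x)"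
      using AE_bounds AE_win AE_space
    proof eventually_elim
      case (elim x)
      show ?case
      proof
        assume "x \<notin> A"
        then obtain k where k: "k \<in> {int I+1..int I+int (h * I)}" "R k x \<noteq> 0"
          using elim by (auto simp: A_def)
        from elim(2) obtain a where a: "a \<le> int I" "R a x \<noteq> 0" by blast
        let ?b = "int I + int (h * I)"
        have ab: "a \<le> ?b" using a by (simp add: add_increasing2)
        define k' where "k' = nat (k - int I)"
        have "?b - a = int (nat (int I - a) + h * I)" using a by simp
        then have c: "nat (?b - a) = nat (int I - a) + h * I" by (simp only: nat_int)
        have s: "payouts_after (a + int (nat (int I - a))) (path x) = payouts_after (int I) (path x)"
          using a by simp
        \<comment> \<open>At time I the two pointers may differ, the stationary one being fixed by
          the win at a; the win at k in the gap merges them.\<close>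
        have "pointer J 0 (payouts_after a (path x)) (nat (?b - a)) = pointer J 0 (payouts_after (int I) (path x)) (h * I)"
          unfolding c pointer_add payouts_after_shift s
          using k by (intro pointer_forget[of _ k']) (auto simp: k'_def payouts_after_def nat_le_iff)
        then have "(\<Sum>i\<in>{?b+1..?b+int I}. stationary_payout J (path x) i) = Z' (path x)"
          unfolding Z'_eq using a ab elim J by (subst sum_stationary_payout[where a = a]) simp_all
        then show "cycle (Suc h) x = Z' (path x)"
          by (simp add: cycle_payout_altdef algebra_simps)
      qed
    qed
  qed (fact cycle_rv)+
qed

text \<open>The error term of \<open>expectation_sum_square_stationary\<close>, with K taken from
  \<open>covariance_cycle_bound\<close> and \<rho> = q.\<close>

definition cov_const :: real where
  "cov_const = 2 * (4 * (I * (B + J)) * (I * (B + J))) / (1 - q)\<^sup>2"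

lemma variance_sum_cycle:
  "\<bar>variance (\<lambda>x. \<Sum>k<m. cycle k x) - m * sigma_sq_bar J I N R\<bar> \<le> cov_const"
proof -
  let ?Y = "\<lambda>k x. cycle k x - mu_bar J I N R"
  let ?\<gamma> = "\<lambda>h. covariance N (cycle 0) (cycle h)"
  have int: "integrable N (cycle k)" for k by (rule integrable_AE_bounded[OF cycle_rv cycle_bounds])
  have "expectation (\<lambda>x. \<Sum>k<m. cycle k x) = m * mu_bar J I N R"
    using int by (simp add: expectation_cycle)
  then have var: "variance (\<lambda>x. \<Sum>k<m. cycle k x) = expectation (\<lambda>x. (\<Sum>k<m. ?Y k x)\<^sup>2)"
    by (simp add: sum_subtractf)
  have sig: "sigma_sq_bar J I N R = ?\<gamma> 0 + 2 * (\<Sum>h. ?\<gamma> (Suc h))"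
    unfolding sigma_sq_bar_def by (simp add: covariance_def power2_eq_square add.commute)
  have "\<bar>expectation (\<lambda>x. (\<Sum>k<m. ?Y k x)\<^sup>2) - m * (?\<gamma> 0 + 2 * (\<Sum>h. ?\<gamma> (Suc h)))\<bar> \<le> cov_const"
    unfolding cov_const_def
  proof (rule expectation_sum_square_stationary)
    have "AE x in N. \<bar>?Y k x\<bar> \<le> I * (B + J) + \<bar>mu_bar J I N R\<bar>" for k
      using cycle_bounds[of k] by eventually_elim linarith
    then show "integrable N (\<lambda>x. ?Y i x * ?Y j x)" for i j
      by (intro integrable_mult_AE_bounded) auto
  qed (use covariance_cycle covariance_cycle_bound q q_nonneg in auto)
  then show ?thesis unfolding var sig .
qed

text \<open>A block holds a whole number l of cycles, so all blocks begin in the same cam position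
  and share one law.\<close>

definition block_var :: "nat \<Rightarrow> real" where
  "block_var l = variance (\<lambda>x. fresh_sum J (path x) 0 (l * I))"

lemma fresh_sum_abs: "AE x in N. \<bar>fresh_sum J (path x) b n\<bar> \<le> n * (B + J)"
  using fresh_sum_AE_bounds
proof eventually_elim
  case (elim x)
  then show ?case using elim[rule_format, of b n] by simp
qed

lemma fresh_sum_integrable [simp]: "integrable N (\<lambda>x. fresh_sum J (path x) b n)"
  by (rule integrable_AE_bounded[OF fresh_sum_rv fresh_sum_abs])

lemma fresh_sum_vs_cycles:
  "AE x in N. \<bar>fresh_sum J (path x) 0 (l * I) - (\<Sum>k<l. cycle k x)\<bar> \<le> J \<and>
     \<bar>\<Sum>k<l. cycle k x\<bar> \<le> (l * I) * (B + J)"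
  using stationary_sum_AE
proof eventually_elim
  case (elim x)
  show ?case using elim[rule_format, of 0 "l * I"]
    unfolding sum_cycle_payout by (simp add: abs_minus_commute)
qed

text \<open>The error does not grow with l. Applied to all complete blocks at once, it keeps the
  centring error bounded in n.\<close>

lemma expectation_fresh_sum:
  "\<bar>expectation (\<lambda>x. fresh_sum J (path x) 0 (l * I)) - l * mu_bar J I N R\<bar> \<le> J"
proof -
  have int: "integrable N (cycle k)" for k by (rule integrable_AE_bounded[OF cycle_rv cycle_bounds])
  have "\<bar>expectation (\<lambda>x. fresh_sum J (path x) 0 (l * I) - (\<Sum>k<l. cycle k x))\<bar> \<le> J"
    using fresh_sum_vs_cycles by (intro expectation_abs_AE_bounded) auto
  then show ?thesis using int by (simp add: expectation_cycle)
qed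

lemma block_var_asymp: "(\<lambda>l. block_var l / real l) \<longlonglongrightarrow> sigma_sq_bar J I N R"
proof -
  let ?s = "sigma_sq_bar J I N R" and ?K = cov_const
  have "((\<lambda>l. block_var l / real l - ?s) \<longlongrightarrow> 0) sequentially"
  proof (rule Lim_null_comparison)
    show "\<forall>\<^sub>F l in sequentially. norm (block_var l / real l - ?s) \<le>
      (?s + ?K / real l) * (1 / sqrt (real l)) + (1 / real l + 1 / sqrt (real l)) * (2 * real J)\<^sup>2 + ?K / real l"
      using eventually_gt_at_top[of 0]
    proof eventually_elim
      case (elim l)
      define v where "v = variance (\<lambda>x. \<Sum>k<l. cycle k x)"
      have v: "\<bar>v - l * ?s\<bar> \<le> ?K" unfolding v_def by (rule variance_sum_cycle)
      \<comment> \<open>The choice \<delta> = 1 / sqrt l balances the two terms: v grows like l, so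
        \<delta> * v and 1 / \<delta> are both of order sqrt l and vanish after division by
        l.\<close>
      have "\<bar>block_var l - v\<bar> \<le> (1 / sqrt l) * v + (1 + 1 / (1 / sqrt l)) * (2 * real J)\<^sup>2"
        unfolding block_var_def v_def
      proof (rule variance_perturbation)
        show "AE x in N. \<bar>fresh_sum J (path x) 0 (l * I)\<bar> \<le> real (l * I) * (B + J)"
          by (rule fresh_sum_abs)
        show "AE x in N. \<bar>\<Sum>k<l. cycle k x\<bar> \<le> real (l * I) * (B + J)"
          using fresh_sum_vs_cycles[of l] by eventually_elim simp
        show "AE x in N. \<bar>fresh_sum J (path x) 0 (l * I) - (\<Sum>k<l. cycle k x)\<bar> \<le> J"
          using fresh_sum_vs_cycles[of l] by eventually_elim simp
      qed (use elim in auto)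
      moreover have "(1 / sqrt l) * v \<le> (1 / sqrt l) * (l * ?s + ?K)"
        using v by (intro mult_left_mono) auto
      ultimately have "\<bar>block_var l - l * ?s\<bar> \<le> (1 / sqrt l) * (l * ?s + ?K) + (1 + sqrt l) * (2 * real J)\<^sup>2 + ?K"
        using v by simp
      then have "\<bar>block_var l - l * ?s\<bar> / l \<le> ((1 / sqrt l) * (l * ?s + ?K) + (1 + sqrt l) * (2 * real J)\<^sup>2 + ?K) / l"
        by (rule divide_right_mono) simp
      also have "\<bar>block_var l - l * ?s\<bar> / l = norm (block_var l / real l - ?s)"
      proof -
        have "block_var l / real l - ?s = (block_var l - l * ?s) / l"
          using elim by (simp add: diff_divide_distrib)
        then show ?thesis by simp
      qed
      also have "((1 / sqrt l) * (l * ?s + ?K) + (1 + sqrt l) * (2 * real J)\<^sup>2 + ?K) / l =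
          (?s + ?K / real l) * (1 / sqrt (real l)) + (1 / real l + 1 / sqrt (real l)) * (2 * real J)\<^sup>2 + ?K / real l"
      proof -
        have "sqrt l / l = 1 / sqrt l" using elim by (simp add: field_simps)
        then show ?thesis using elim
          by (simp add: add_divide_distrib distrib_left distrib_right) (simp add: field_simps)
      qed
      finally show ?case .
    qed
    have 2: "(\<lambda>l. 1 / real l) \<longlonglongrightarrow> 0" by (rule lim_1_over_n)
    have 1: "(\<lambda>l. 1 / sqrt (real l)) \<longlonglongrightarrow> 0"
      using tendsto_real_sqrt[OF 2] by (simp add: real_sqrt_divide)
    have 3: "(\<lambda>l. ?K / real l) \<longlonglongrightarrow> 0" by (rule lim_const_over_n)
    have "(\<lambda>l. (?s + ?K / real l) * (1 / sqrt (real l)) + (1 / real l + 1 / sqrt (real l)) * (2 * real J)\<^sup>2 + ?K / real l)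
       \<longlonglongrightarrow> (?s + 0) * 0 + (0 + 0) * (2 * real J)\<^sup>2 + 0"
      by (intro tendsto_intros 1 2 3)
    then show "(\<lambda>l. (?s + ?K / real l) * (1 / sqrt (real l)) + (1 / real l + 1 / sqrt (real l)) * (2 * real J)\<^sup>2 + ?K / real l)
       \<longlonglongrightarrow> 0" by simp
  qed
  then show ?thesis by (simp add: LIM_zero_iff)
qed

section \<open>The blocks and the carries\<close>

abbreviation block :: "nat \<Rightarrow> nat \<Rightarrow> 'b \<Rightarrow> real" where
  "block l j x \<equiv> fresh_sum J (path x) (int (j * (l * I))) (l * I)"

text \<open>Each reset block reads only its own window K j of times, and the windows are
  disjoint.\<close>

lemma block_indep: "indep_vars (\<lambda>_. borel) (block l) UNIV"
proof -
  define K where "K j = {int (j * (l * I)) + 1..int (j * (l * I)) + int (l * I)}" for j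
  have "disjoint_family K"
    unfolding disjoint_family_on_def
  proof safe
    have "False" if "i < j" "k \<in> K i" "k \<in> K j" for i j k
    proof -
      have "Suc i * (l * I) \<le> j * (l * I)" using that(1) by (intro mult_le_mono1) simp
      then have "i * (l * I) + l * I \<le> j * (l * I)" by simp
      then have "int (i * (l * I)) + int (l * I) \<le> int (j * (l * I))" by (simp only: of_nat_add[symmetric] of_nat_le_iff)
      with that(2,3) show False unfolding K_def atLeastAtMost_iff by linarith
    qed
    then show "k \<in> {}" if "i \<noteq> j" "k \<in> K i" "k \<in> K j" for i j k
      using that by (metis linorder_neqE_nat)
  qed
  then have "indep_vars (\<lambda>j. PiM (K j) (\<lambda>_. borel)) (\<lambda>j x. restrict (path x) (K j)) UNIV"
    by (intro indep_vars_restrict[OF indep]) auto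
  then have "indep_vars (\<lambda>_. borel)
      (\<lambda>j x. fresh_sum J (restrict (path x) (K j)) (int (j * (l * I))) (l * I)) UNIV"
    by (rule indep_vars_compose2) (intro measurable_fresh_sum, auto simp: K_def)
  moreover have "fresh_sum J (restrict (path x) (K j)) (int (j * (l * I))) (l * I) = block l j x" for j x
    by (intro fresh_sum_cong) (auto simp: K_def)
  ultimately show ?thesis by simp
qed

text \<open>Block j is the first block seen after j * l whole periods, which is the form required by
  \<open>distr_shift\<close>.\<close>

lemma block_shift: "block l j x = fresh_sum J (\<lambda>n. R (n + int (j * l) * int I) x) 0 (l * I)"
  using fresh_sum_shift[of J "path x" 0 "int (j * (l * I))" "l * I"] by (simp add: mult.assoc)

lemma measurable_fresh_sum_PiM [measurable]:
  "(\<lambda>r. fresh_sum J r b n) \<in> borel_measurable (PiM UNIV (\<lambda>_. borel))"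
  by (intro measurable_fresh_sum) simp

lemma block_distr: "distr N borel (block l j) = distr N borel (\<lambda>x. fresh_sum J (path x) 0 (l * I))"
  using distr_shift[of "\<lambda>r. fresh_sum J r 0 (l * I)" "j * l"] unfolding block_shift by simp

definition block_mean :: "nat \<Rightarrow> real" where
  "block_mean l = expectation (\<lambda>x. fresh_sum J (path x) 0 (l * I))"

lemma block_expectation: "expectation (block l j) = block_mean l"
  using expectation_shift[of "\<lambda>r. fresh_sum J r 0 (l * I)" "j * l"]
  unfolding block_shift block_mean_def by simp

lemma block_variance: "variance (block l j) = block_var l"
  using expectation_shift[of "\<lambda>r. (fresh_sum J r 0 (l * I) - block_mean l)\<^sup>2" "j * l"]
  unfolding block_expectation block_var_def block_mean_def[symmetric] unfolding block_shift by simp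

lemma block_clt:
  assumes "block_var l > 0"
  shows "weak_conv_m (\<lambda>m. distr N borel (\<lambda>x. (\<Sum>j<m. block l j x - block_mean l) / sqrt (m * block_var l)))
    std_normal_distribution"
proof -
  have "weak_conv_m (\<lambda>m. distr N borel (\<lambda>x. (\<Sum>j<m. block l j x - block_mean l) / sqrt (m * (sqrt (block_var l))\<^sup>2)))
    std_normal_distribution"
  proof (rule central_limit_theorem[OF block_indep block_expectation])
    show "integrable N (\<lambda>x. (block l j x)\<^sup>2)" for j
      unfolding power2_eq_square by (rule integrable_mult_AE_bounded[OF _ _ fresh_sum_abs fresh_sum_abs]) simp_all
    show "variance (block l j) = (sqrt (block_var l))\<^sup>2" for j
      unfolding block_variance using assms by simp
    show "sqrt (block_var l) > 0" using assms by simp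
  qed (rule block_distr)
  then show ?thesis using assms by simp
qed

text \<open>Independence makes the cross terms vanish. The geometric estimate is used with \<rho> =
  0, and its value at \<rho> = 0 supplies the factor 1 + 2 / (1 - 0) = 3, a harmless loss.\<close>

lemma block_sum_second_moment:
  "expectation (\<lambda>x. (\<Sum>j<m. block l j x - block_mean l)\<^sup>2) \<le> m * (block_var l * 3)"
proof -
  have bd: "AE x in N. \<bar>block l j x - block_mean l\<bar> \<le> (l * I) * (B + J) + \<bar>block_mean l\<bar>" for j
    using fresh_sum_abs[of "int (j * (l * I))" "l * I"] by eventually_elim linarith
  have "expectation (\<lambda>x. (\<Sum>j<m. block l j x - block_mean l)\<^sup>2) \<le> m * (block_var l * (1 + 2 / (1 - 0)))"
  proof (rule expectation_sum_square_le)
    show "integrable N (\<lambda>x. (block l i x - block_mean l) * (block l j x - block_mean l))" for i j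
      by (intro integrable_mult_AE_bounded[OF _ _ bd bd]) auto
    show "expectation (\<lambda>x. (block l i x - block_mean l)\<^sup>2) \<le> block_var l" for i
      using block_variance[where l = l and j = i] unfolding block_expectation by (rule eq_refl)
    show "block_var l \<ge> 0" unfolding block_var_def by (rule variance_positive)
    show "\<bar>expectation (\<lambda>x. (block l i x - block_mean l) * (block l j x - block_mean l))\<bar>
       \<le> block_var l * 0 ^ (j - Suc i)" if "i < j" for i j
    proof -
      have "indep_vars (\<lambda>_. borel) (\<lambda>j x. block l j x - block_mean l) UNIV"
        by (rule indep_vars_compose2[OF block_indep]) auto
      then have "indep_var borel (\<lambda>x. block l i x - block_mean l) borel (\<lambda>x. block l j x - block_mean l)"
        using that by (intro indep_var_of_indep_vars) auto
      then have "expectation (\<lambda>x. (block l i x - block_mean l) * (block l j x - block_mean l)) =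
          expectation (\<lambda>x. block l i x - block_mean l) * expectation (\<lambda>x. block l j x - block_mean l)"
        by (rule indep_var_lebesgue_integral) auto
      also have "\<dots> = 0" by (simp add: block_expectation prob_space del: of_nat_mult)
      finally show ?thesis using \<open>block_var l \<ge> 0\<close> by simp
    qed
  qed auto
  then show ?thesis by simp
qed

section \<open>Awards lost by resetting: second moments\<close>

abbreviation carry_in :: "nat \<Rightarrow> nat \<Rightarrow> 'b \<Rightarrow> real" where
  "carry_in l j x \<equiv> carry J (path x) 0 (j * (l * I)) (l * I)"

lemma carry_abs: "\<bar>carry J r b m n\<bar> \<le> J"
  using carry_bounds[OF J, of r b m n] by simp

lemma carry_integrable [simp]: "integrable N (\<lambda>x. carry J (path x) b m n)"
  by (rule integrable_AE_bounded[OF carry_rv]) (auto intro: carry_abs)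

text \<open>Carry i is settled by time c, the end of block i. If a win falls among the h coups
  between c and the start of block j, carry j equals the carry of a machine started at c, which is
  independent of carry i. Since carries never exceed J, the bound is free of l.\<close>

lemma carry_covariance:
  assumes l: "l \<ge> 1" and ij: "i < j"
  shows "\<bar>covariance N (carry_in l i) (carry_in l j)\<bar> \<le> 4 * real J * real J * q ^ (j - Suc i)"
proof -
  define L where "L = l * I"
  define c where "c = Suc i * L"
  define h where "h = (j - Suc i) * L"
  have L: "L \<ge> 1" using l I by (simp add: L_def)
  have jL: "j * L = c + h"
    unfolding c_def h_def using ij by (subst distrib_right[symmetric]) simp
  define A where "A = {x \<in> space N. \<forall>k\<in>{int c+1..int c+int h}. R k x = 0}"
  have ind: "indep_var borel (\<lambda>x. carry J (restrict (path x) {..int c}) 0 (i * L) L)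
      borel (\<lambda>x. carry J (restrict (path x) {int c+1..}) (int c) h L)"
  proof (rule indep_functionals)
    show "(\<lambda>r. carry J r 0 (i * L) L) \<in> borel_measurable (PiM {..int c} (\<lambda>_. borel))"
      by (intro measurable_carry) (auto simp: c_def algebra_simps)
    show "(\<lambda>r. carry J r (int c) h L) \<in> borel_measurable (PiM {int c+1..} (\<lambda>_. borel))"
      by (intro measurable_carry) auto
  qed auto
  have "carry J (restrict (path x) {..int c}) 0 (i * L) L = carry J (path x) 0 (i * L) L" for x
    by (intro carry_cong) (auto simp: c_def algebra_simps)
  moreover have "carry J (restrict (path x) {int c+1..}) (int c) h L = carry J (path x) (int c) h L" for x
    by (intro carry_cong) auto
  ultimately have ind': "indep_var borel (\<lambda>x. carry J (path x) 0 (i * L) L)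
      borel (\<lambda>x. carry J (path x) (int c) h L)"
    using ind by simp
  have "\<bar>covariance N (\<lambda>x. carry J (path x) 0 (i * L) L) (\<lambda>x. carry J (path x) 0 (j * L) L)\<bar>
      \<le> 4 * real J * real J * q ^ (j - Suc i)"
  proof (rule covariance_approx_indep[OF _ _ _ _ _ _ ind'])
    show "A \<in> events" unfolding A_def by measurable
    have "prob A \<le> q ^ h" unfolding A_def by (rule prob_no_win)
    also have "\<dots> \<le> q ^ (j - Suc i)"
      using q q_nonneg L unfolding h_def by (intro power_decreasing) auto
    finally show "prob A \<le> q ^ (j - Suc i)" .
    show "AE x in N. x \<notin> A \<longrightarrow> carry J (path x) 0 (j * L) L = carry J (path x) (int c) h L"
      using AE_space
    proof eventually_elim
      case (elim x)
      show ?case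
      proof
        assume "x \<notin> A"
        then obtain k where k: "k \<in> {int c+1..int c+int h}" "R k x \<noteq> 0"
          using elim by (auto simp: A_def)
        show "carry J (path x) 0 (j * L) L = carry J (path x) (int c) h L"
          unfolding jL using carry_forget[of "path x" k 0 c h J L] k by simp
      qed
    qed
  qed (auto intro: carry_abs)
  then show ?thesis by (simp add: L_def)
qed

text \<open>Second moment per block of the centred carries, from
  \<open>expectation_sum_square_le\<close> with K = 4 J J and \<rho> = q. It is independent of l, so
  longer blocks make the total over n coups small.\<close>

definition carry_const :: real where
  "carry_const = 4 * real J * real J * (1 + 2 / (1 - q))"

lemma carry_sum_mean_deviation:
  assumes l: "l \<ge> 1"
  shows "expectation (\<lambda>x. \<bar>\<Sum>j<m. carry_in l j x - expectation (carry_in l j)\<bar>) \<le> sqrt (m * carry_const)"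
proof -
  let ?Y = "\<lambda>j x. carry_in l j x - expectation (carry_in l j)"
  have E: "\<bar>expectation (carry_in l j)\<bar> \<le> J" for j
    by (intro expectation_abs_AE_bounded) (auto intro: carry_abs)
  have bd: "\<bar>?Y j x\<bar> \<le> 2 * J" for j x
    using carry_abs[of "path x" 0 "j * (l * I)" "l * I"] E[of j] by linarith
  have int: "integrable N (\<lambda>x. ?Y i x * ?Y j x)" for i j
    by (rule integrable_mult_AE_bounded[OF _ _ AE_I2[OF bd] AE_I2[OF bd]]) simp_all
  have sq: "expectation (\<lambda>x. (\<Sum>j<m. ?Y j x)\<^sup>2) \<le> m * (4 * real J * real J * (1 + 2 / (1 - q)))"
  proof (rule expectation_sum_square_le[OF int])
    show "expectation (\<lambda>x. (?Y i x)\<^sup>2) \<le> 4 * real J * real J" for i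
    proof -
      have "(?Y i x)\<^sup>2 \<le> 4 * real J * real J" for x
        using abs_le_square_iff[of "?Y i x" "2 * J"] bd[of x i] by (simp add: power2_eq_square)
      then have "expectation (\<lambda>x. (?Y i x)\<^sup>2) \<le> expectation (\<lambda>x. 4 * real J * real J)"
        using int[of i i] by (intro integral_mono) (auto simp: power2_eq_square)
      then show ?thesis by (simp add: prob_space)
    qed
    show "\<bar>expectation (\<lambda>x. ?Y i x * ?Y j x)\<bar> \<le> 4 * real J * real J * q ^ (j - Suc i)" if "i < j" for i j
      using carry_covariance[OF l that] by (simp add: covariance_def)
  qed (use q q_nonneg in auto)
  have "expectation (\<lambda>x. \<bar>\<Sum>j<m. ?Y j x\<bar>) \<le> sqrt (expectation (\<lambda>x. (\<Sum>j<m. ?Y j x)\<^sup>2))"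
  proof (rule expectation_abs_le_sqrt)
    show "integrable N (\<lambda>x. (\<Sum>j<m. ?Y j x)\<^sup>2)"
      unfolding power2_eq_square sum_product using int by simp
  qed simp
  also have "\<dots> \<le> sqrt (m * carry_const)"
    using sq unfolding carry_const_def by simp
  finally show ?thesis .
qed

section \<open>The central limit theorem\<close>

text \<open>J for the different pointer at time i0, and i0 * (B + J) for the i0 coups by which the
  two windows of length n are displaced.\<close>

definition start_const :: "nat \<Rightarrow> real" where
  "start_const i0 = J + i0 * (B + J)"

lemma payout_sum_vs_fresh_sum:
  assumes j0: "j0 < J"
  shows "AE x in N. \<forall>n. \<bar>payout_sum J j0 (payouts_after (int i0) (path x)) n - fresh_sum J (path x) 0 n\<bar>
    \<le> start_const i0"
  using AE_bounds
proof eventually_elim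
  case (elim x)
  show ?case
  proof
    fix n
    let ?s = "\<lambda>b. payouts_after (int b) (path x)"
    let ?p = "\<lambda>n. pointer J 0 (payouts_after 0 (path x)) n"
    have nonneg: "0 \<le> payout_sum J j (?s b) n \<and> payout_sum J j (?s b) n \<le> n * (B + J)" for j b n
      using elim by (intro payout_sum_bounds) (auto simp: payouts_after_def)
    \<comment> \<open>The sum over i0 + n coups is split in two ways, after i0 coups and after n
      coups; the long sums then differ only by two sums over i0 coups.\<close>
    have "fresh_sum J (path x) 0 i0 + payout_sum J (?p i0) (?s i0) n = fresh_sum J (path x) 0 (i0 + n)"
      using fresh_sum_add[of J "path x" 0 i0 n] by simp
    also have "\<dots> = fresh_sum J (path x) 0 n + payout_sum J (?p n) (?s n) i0"
      using fresh_sum_add[of J "path x" 0 n i0] by (simp add: add.commute)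
    finally have "payout_sum J (?p i0) (?s i0) n - fresh_sum J (path x) 0 n =
        payout_sum J (?p n) (?s n) i0 - payout_sum J 0 (?s 0) i0"
      by (simp add: fresh_sum_def)
    moreover have "?p i0 < J" using J by (intro pointer_less) auto
    then have "\<bar>payout_sum J j0 (?s i0) n - payout_sum J (?p i0) (?s i0) n\<bar> \<le> J"
      using J j0 by (intro payout_sum_diff)
    ultimately show "\<bar>payout_sum J j0 (?s i0) n - fresh_sum J (path x) 0 n\<bar> \<le> start_const i0"
      using nonneg[of "?p n" n i0] nonneg[of 0 0 i0] unfolding start_const_def by linarith
  qed
qed

lemma fresh_sum_div:
  assumes L: "L \<ge> 1"
  shows "AE x in N. \<forall>n. \<bar>fresh_sum J (path x) 0 n - fresh_sum J (path x) 0 (n div L * L)\<bar> \<le> L * (B + J)"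
  using AE_bounds
proof eventually_elim
  case (elim x)
  show ?case
  proof
    fix n
    let ?S = "payout_sum J (pointer J 0 (payouts_after 0 (path x)) (n div L * L))
      (payouts_after (0 + int (n div L * L)) (path x)) (n mod L)"
    have "0 \<le> ?S \<and> ?S \<le> (n mod L) * (B + J)"
      using elim by (intro payout_sum_bounds) (auto simp: payouts_after_def)
    moreover have "(n mod L) * (B + J) \<le> L * (B + J)"
      using L B_nonneg by (intro mult_right_mono) (auto simp: less_imp_le)
    moreover have "fresh_sum J (path x) 0 n = fresh_sum J (path x) 0 (n div L * L) + ?S"
      using fresh_sum_add[of J "path x" 0 "n div L * L" "n mod L"] by simp
    ultimately show "\<bar>fresh_sum J (path x) 0 n - fresh_sum J (path x) 0 (n div L * L)\<bar> \<le> L * (B + J)"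
      by linarith
  qed
qed

text \<open>In this order: the initial state, the incomplete last block, the error of
  \<open>expectation_fresh_sum\<close>, and the centring of the coups in the incomplete block. All
  are free of n and vanish after division by sqrt n.\<close>

definition error_const :: "nat \<Rightarrow> nat \<Rightarrow> real" where
  "error_const i0 l = start_const i0 + (l * I) * (B + J) + J + l * \<bar>mu_bar J I N R\<bar>"

text \<open>Of all the differences between the machine and the independent blocks, only the centred
  carries grow with n, and they grow like the square root of the number of blocks.\<close>

lemma centred_sum_approx:
  assumes j0: "j0 < J" and l: "l \<ge> 1"
  defines "L \<equiv> l * I"
  shows "expectation (\<lambda>x. \<bar>(payout_sum J j0 (payouts_after (int i0) (path x)) n - n * (mu_bar J I N R / I))
      - (\<Sum>j<n div L. block l j x - block_mean l)\<bar>) \<le> error_const i0 l + sqrt (real (n div L) * carry_const)"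
    and "integrable N (\<lambda>x. payout_sum J j0 (payouts_after (int i0) (path x)) n)"
proof -
  let ?S = "\<lambda>x. payout_sum J j0 (payouts_after (int i0) (path x)) n"
  let ?\<mu> = "mu_bar J I N R / I"
  define m where "m = n div L"
  have L: "L \<ge> 1" using l I by (simp add: L_def)
  have Srv [measurable]: "?S \<in> borel_measurable N"
    by (intro measurable_payout_sum) (simp add: payouts_after_def)
  have "AE x in N. \<bar>?S x\<bar> \<le> n * (B + J)"
    using AE_bounds
  proof eventually_elim
    case (elim x)
    then have "0 \<le> ?S x \<and> ?S x \<le> n * (B + J)"
      by (intro payout_sum_bounds) (auto simp: payouts_after_def)
    then show ?case by simp
  qed
  then show S_int: "integrable N ?S" by (rule integrable_AE_bounded[OF Srv])
  let ?D = "\<lambda>x. \<Sum>j<m. carry_in l j x - expectation (carry_in l j)"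
  have blocks: "fresh_sum J r 0 (m * L) = (\<Sum>j<m. fresh_sum J r (int (j * L)) L) + (\<Sum>j<m. carry J r 0 (j * L) L)" for r
    by (rule fresh_sum_blocks)
  \<comment> \<open>Block means and carry means together make up the mean of the unreset sum, which
    is known up to J; neither part is evaluated separately.\<close>
  have "expectation (\<lambda>x. fresh_sum J (path x) 0 (m * L)) = m * block_mean l + (\<Sum>j<m. expectation (carry_in l j))"
    unfolding blocks unfolding L_def
    by (simp add: block_expectation del: of_nat_mult)
  moreover have "\<bar>expectation (\<lambda>x. fresh_sum J (path x) 0 (m * L)) - m * l * mu_bar J I N R\<bar> \<le> J"
    using expectation_fresh_sum[of "m * l"] by (simp add: L_def mult.assoc)
  moreover have "\<bar>n * ?\<mu> - m * l * mu_bar J I N R\<bar> \<le> l * \<bar>mu_bar J I N R\<bar>"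
  proof -
    have "n = m * L + n mod L" by (simp add: m_def)
    then have "n * ?\<mu> = real (m * L + n mod L) * ?\<mu>" by simp
    also have "\<dots> = m * l * mu_bar J I N R + (n mod L) * ?\<mu>"
      using I by (simp add: L_def field_simps)
    finally have "\<bar>n * ?\<mu> - m * l * mu_bar J I N R\<bar> = (n mod L) * \<bar>?\<mu>\<bar>"
      by (simp add: abs_mult)
    also have "\<dots> \<le> L * \<bar>?\<mu>\<bar>"
      using L by (intro mult_right_mono) (auto simp: less_imp_le)
    also have "\<dots> = l * \<bar>mu_bar J I N R\<bar>" using I by (simp add: L_def)
    finally show ?thesis .
  qed
  ultimately have mean: "\<bar>m * block_mean l + (\<Sum>j<m. expectation (carry_in l j)) - n * ?\<mu>\<bar>
      \<le> J + l * \<bar>mu_bar J I N R\<bar>"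
    by linarith
  have "AE x in N. \<bar>(?S x - n * ?\<mu>) - (\<Sum>j<m. block l j x - block_mean l)\<bar> \<le> error_const i0 l + \<bar>?D x\<bar>"
    using payout_sum_vs_fresh_sum[OF j0, of i0] fresh_sum_div[OF L]
  proof eventually_elim
    case (elim x)
    have 1: "\<bar>?S x - fresh_sum J (path x) 0 n\<bar> \<le> start_const i0" using elim(1) by blast
    have 2: "\<bar>fresh_sum J (path x) 0 n - fresh_sum J (path x) 0 (m * L)\<bar> \<le> L * (B + J)"
      using elim(2) unfolding m_def by blast
    have 3: "fresh_sum J (path x) 0 (m * L) = (\<Sum>j<m. block l j x - block_mean l) + m * block_mean l
        + ?D x + (\<Sum>j<m. expectation (carry_in l j))"
      unfolding blocks unfolding L_def by (simp add: sum_subtractf)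
    show ?case
      using 1 2 mean unfolding 3 unfolding error_const_def L_def by linarith
  qed
  then have "expectation (\<lambda>x. \<bar>(?S x - n * ?\<mu>) - (\<Sum>j<m. block l j x - block_mean l)\<bar>)
      \<le> expectation (\<lambda>x. error_const i0 l + \<bar>?D x\<bar>)"
    using S_int by (intro integral_mono_AE) auto
  also have "\<dots> = error_const i0 l + expectation (\<lambda>x. \<bar>?D x\<bar>)" by (simp add: prob_space)
  also have "expectation (\<lambda>x. \<bar>?D x\<bar>) \<le> sqrt (m * carry_const)"
    by (rule carry_sum_mean_deviation[OF l])
  finally show "expectation (\<lambda>x. \<bar>(?S x - n * ?\<mu>) - (\<Sum>j<n div L. block l j x - block_mean l)\<bar>)
    \<le> error_const i0 l + sqrt (real (n div L) * carry_const)"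
    by (simp add: m_def)
qed

text \<open>Controls the cost of replacing the block normalization by that of the theorem.\<close>

lemma block_sum_mean_abs:
  assumes "block_var l > 0" "m \<ge> 1"
  shows "expectation (\<lambda>x. \<bar>(\<Sum>j<m. block l j x - block_mean l) / sqrt (m * block_var l)\<bar>) \<le> 2"
proof -
  let ?T = "\<lambda>x. \<Sum>j<m. block l j x - block_mean l"
  have bd: "AE x in N. \<bar>block l j x - block_mean l\<bar> \<le> (l * I) * (B + J) + \<bar>block_mean l\<bar>" for j
    using fresh_sum_abs[of "int (j * (l * I))" "l * I"] by eventually_elim linarith
  have "integrable N (\<lambda>x. (?T x)\<^sup>2)"
    unfolding power2_eq_square sum_product
    by (intro Bochner_Integration.integrable_sum integrable_mult_AE_bounded[OF _ _ bd bd]) auto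
  then have "expectation (\<lambda>x. \<bar>?T x\<bar>) \<le> sqrt (expectation (\<lambda>x. (?T x)\<^sup>2))"
    by (intro expectation_abs_le_sqrt) auto
  \<comment> \<open>The factor 3 of the second moment is rounded up to 4 to have the root 2.\<close>
  also have "\<dots> \<le> sqrt (4 * (m * block_var l))"
  proof -
    have "0 < m * block_var l" using assms by simp
    then show ?thesis using block_sum_second_moment[of l m] by simp
  qed
  also have "\<dots> = 2 * sqrt (m * block_var l)" by (simp add: real_sqrt_mult)
  finally have "expectation (\<lambda>x. \<bar>?T x\<bar>) / sqrt (m * block_var l) \<le> 2"
    using assms by (simp add: divide_le_eq)
  then show ?thesis using assms by (simp add: abs_divide)
qed

theorem payout_sum_clt:
  assumes j0: "j0 < J" and sig: "sigma_sq_bar J I N R > 0"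
  shows "weak_conv_m (\<lambda>n. distr N borel (\<lambda>x.
      (payout_sum J j0 (payouts_after (int i0) (path x)) n - n * (mu_bar J I N R / I))
        / sqrt (n * (sigma_sq_bar J I N R / I)))) std_normal_distribution"
proof (rule weak_conv_m_approx)
  let ?\<mu> = "mu_bar J I N R / I" and ?\<sigma> = "sigma_sq_bar J I N R / I"
  let ?S = "\<lambda>n x. payout_sum J j0 (payouts_after (int i0) (path x)) n"
  have s: "?\<sigma> > 0" using sig I by simp
  have [measurable]: "?S n \<in> borel_measurable N" for n
    by (intro measurable_payout_sum) (simp add: payouts_after_def)
  show "random_variable borel (\<lambda>x. (?S n x - n * ?\<mu>) / sqrt (n * ?\<sigma>))" for n
    by measurable
  show "real_distribution std_normal_distribution"
    by (rule real_dist_normal_dist)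
  fix e :: real assume e: "e > 0"
  \<comment> \<open>Ratio of the variance per coup of reset blocks to the limiting variance per
    coup.\<close>
  define v where "v = (\<lambda>l. block_var l / (l * I) / ?\<sigma>)"
  have v_lim: "v \<longlonglongrightarrow> 1"
  proof -
    have "v = (\<lambda>l. block_var l / l / sigma_sq_bar J I N R)"
      using I by (simp add: v_def fun_eq_iff)
    moreover have "(\<lambda>l. block_var l / l / sigma_sq_bar J I N R) \<longlonglongrightarrow> sigma_sq_bar J I N R / sigma_sq_bar J I N R"
      using sig by (intro tendsto_divide block_var_asymp tendsto_const) auto
    ultimately show ?thesis using sig by simp
  qed
  \<comment> \<open>What remains of the error after n tends to infinity with l fixed: the centred
    carries, and the mismatch between the two normalizations.\<close>
  have "(\<lambda>l. sqrt (1 / l * (carry_const / (I * ?\<sigma>))) + 2 * \<bar>sqrt (v l) - 1\<bar>)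
      \<longlonglongrightarrow> sqrt (0 * (carry_const / (I * ?\<sigma>))) + 2 * \<bar>sqrt 1 - 1\<bar>"
    by (intro tendsto_intros lim_1_over_n v_lim)
  then have "\<forall>\<^sub>F l in sequentially. sqrt (1 / l * (carry_const / (I * ?\<sigma>))) + 2 * \<bar>sqrt (v l) - 1\<bar> < e"
    using e by (intro order_tendstoD) auto
  moreover have "\<forall>\<^sub>F l in sequentially. v l > 0"
    using v_lim by (rule order_tendstoD) simp
  ultimately have "\<forall>\<^sub>F l in sequentially. l \<ge> 1 \<and> v l > 0 \<and>
      sqrt (1 / l * (carry_const / (I * ?\<sigma>))) + 2 * \<bar>sqrt (v l) - 1\<bar> < e"
    using eventually_ge_at_top[of 1] by eventually_elim auto
  then obtain l where l: "l \<ge> 1" "v l > 0"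
    and le: "sqrt (1 / l * (carry_const / (I * ?\<sigma>))) + 2 * \<bar>sqrt (v l) - 1\<bar> < e"
    by (auto dest: eventually_happens)
  define L where "L = l * I"
  have L: "L \<ge> 1" using l I by (simp add: L_def)
  have V: "block_var l > 0"
    using l L s by (simp add: v_def zero_less_divide_iff)
  define T where "T = (\<lambda>m x. \<Sum>j<m. block l j x - block_mean l)"
  define U where "U = (\<lambda>n x. T (n div L) x / sqrt (real (n div L) * block_var l))"
  have [measurable]: "T m \<in> borel_measurable N" for m unfolding T_def by measurable
  have T_int: "integrable N (T m)" for m unfolding T_def by auto
  have divlim: "filterlim (\<lambda>n. n div L) at_top sequentially"
    using L by (intro filterlim_at_top_div_const_nat) simp
  \<comment> \<open>Bound for the mean absolute difference between the normalized payout and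
    \<open>U n\<close>; its limit in n is the expression that the choice of l has made smaller than
    e.\<close>
  define g where "g = (\<lambda>n. error_const i0 l / sqrt (n * ?\<sigma>) + sqrt (real (n div L) / real n * (carry_const / ?\<sigma>))
      + 2 * \<bar>sqrt (real (n div L) / real n * (block_var l / ?\<sigma>)) - 1\<bar>)"
  have "g \<longlonglongrightarrow> 0 + sqrt (1 / L * (carry_const / ?\<sigma>)) + 2 * \<bar>sqrt (1 / L * (block_var l / ?\<sigma>)) - 1\<bar>"
  proof -
    have "(\<lambda>n. (error_const i0 l / sqrt ?\<sigma>) * sqrt (1 / real n)) \<longlonglongrightarrow> (error_const i0 l / sqrt ?\<sigma>) * sqrt 0"
      by (intro tendsto_intros lim_1_over_n)
    then have lim0: "(\<lambda>n. error_const i0 l / sqrt (n * ?\<sigma>)) \<longlonglongrightarrow> 0"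
      by (simp add: real_sqrt_mult real_sqrt_divide mult.commute)
    show ?thesis
      unfolding g_def
      by (intro tendsto_add tendsto_mult tendsto_real_sqrt tendsto_rabs tendsto_diff tendsto_const
          lim0 div_nat_asymp[OF L])
  qed
  also have "0 + sqrt (1 / L * (carry_const / ?\<sigma>)) + 2 * \<bar>sqrt (1 / L * (block_var l / ?\<sigma>)) - 1\<bar>
     = sqrt (1 / l * (carry_const / (I * ?\<sigma>))) + 2 * \<bar>sqrt (v l) - 1\<bar>"
    by (simp add: L_def v_def)
  finally have g_ev: "\<forall>\<^sub>F n in sequentially. g n < e"
    using le by (rule order_tendstoD)
  show "\<exists>U. (\<forall>n. random_variable borel (U n)) \<and>
      weak_conv_m (\<lambda>n. distr N borel (U n)) std_normal_distribution \<and>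
      (\<forall>\<^sub>F n in sequentially. integrable N (\<lambda>x. (?S n x - n * ?\<mu>) / sqrt (n * ?\<sigma>) - U n x) \<and>
         expectation (\<lambda>x. \<bar>(?S n x - n * ?\<mu>) / sqrt (n * ?\<sigma>) - U n x\<bar>) \<le> e)"
  proof (intro exI[of _ U] conjI allI)
    show "random_variable borel (U n)" for n unfolding U_def by measurable
    show "weak_conv_m (\<lambda>n. distr N borel (U n)) std_normal_distribution"
      using weak_conv_m_subseq[OF block_clt[OF V] divlim] by (simp add: U_def T_def)
    have "\<forall>\<^sub>F n in sequentially. n div L \<ge> 1"
      using divlim by (simp add: filterlim_at_top)
    then show "\<forall>\<^sub>F n in sequentially. integrable N (\<lambda>x. (?S n x - n * ?\<mu>) / sqrt (n * ?\<sigma>) - U n x) \<and>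
         expectation (\<lambda>x. \<bar>(?S n x - n * ?\<mu>) / sqrt (n * ?\<sigma>) - U n x\<bar>) \<le> e"
      using g_ev
    proof eventually_elim
      case (elim n)
      define m where "m = n div L"
      have m: "m \<ge> 1" and n: "n \<ge> 1" using elim(1) by (cases n; simp add: m_def)+
      define a where "a = sqrt (n * ?\<sigma>)"
      define b where "b = sqrt (m * block_var l)"
      have a: "a > 0" using n s mult_pos_pos[of "real n" ?\<sigma>] unfolding a_def by (intro real_sqrt_gt_zero) simp
      have b: "b > 0" using m V unfolding b_def by (intro real_sqrt_gt_zero mult_pos_pos) auto
      let ?E = "\<lambda>x. (?S n x - n * ?\<mu>) - T m x"
      have S_int: "integrable N (?S n)" by (rule centred_sum_approx(2)[OF j0 l(1)])
      have U_eq: "U n = (\<lambda>x. T m x / b)" by (simp add: U_def m_def b_def)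
      \<comment> \<open>Separates the error in the numerator from the change of normalization from b
        to a.\<close>
      have "(?S n x - n * ?\<mu>) / a - U n x = ?E x / a + U n x * (b / a - 1)" for x
        unfolding U_eq using a b by (simp add: field_simps)
      then have le: "\<bar>(?S n x - n * ?\<mu>) / a - U n x\<bar> \<le> \<bar>?E x\<bar> / a + \<bar>U n x\<bar> * \<bar>b / a - 1\<bar>" for x
        using a abs_triangle_ineq[of "?E x / a" "U n x * (b / a - 1)"] by (simp add: abs_mult)
      have U_int: "integrable N (U n)" unfolding U_eq using T_int by simp
      have int: "integrable N (\<lambda>x. (?S n x - n * ?\<mu>) / a - U n x)"
        using S_int U_int by auto
      have "expectation (\<lambda>x. \<bar>(?S n x - n * ?\<mu>) / a - U n x\<bar>)
          \<le> expectation (\<lambda>x. \<bar>?E x\<bar> / a + \<bar>U n x\<bar> * \<bar>b / a - 1\<bar>)"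
        using S_int U_int T_int[of m] int le by (intro integral_mono) auto
      also have "\<dots> = expectation (\<lambda>x. \<bar>?E x\<bar>) / a + expectation (\<lambda>x. \<bar>U n x\<bar>) * \<bar>b / a - 1\<bar>"
        using S_int U_int T_int[of m] by simp
      also have "\<dots> \<le> (error_const i0 l + sqrt (m * carry_const)) / a + 2 * \<bar>b / a - 1\<bar>"
      proof (intro add_mono divide_right_mono mult_right_mono)
        show "expectation (\<lambda>x. \<bar>?E x\<bar>) \<le> error_const i0 l + sqrt (m * carry_const)"
          using centred_sum_approx(1)[OF j0 l(1), of i0 n] by (simp add: T_def m_def L_def)
        show "expectation (\<lambda>x. \<bar>U n x\<bar>) \<le> 2"
          using block_sum_mean_abs[OF V m] by (simp add: U_eq T_def b_def)
      qed (use a in auto)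
      also have "\<dots> = g n"
        unfolding g_def a_def b_def m_def
        by (simp add: add_divide_distrib distrib_right mult.assoc real_sqrt_mult real_sqrt_divide)
      finally show ?case using elim int unfolding a_def by simp
    qed
  qed
qed

end

section \<open>Transfer from the stationary process to the machine\<close>

theorem theorem3:
  fixes J d I i0 j0 :: nat
    and D :: "nat \<Rightarrow> real measure"
    and p :: "nat \<Rightarrow> real"
    and M :: "'a measure" and Rhat :: "nat \<Rightarrow> 'a \<Rightarrow> real"
    and N :: "'b measure" and R :: "int \<Rightarrow> 'b \<Rightarrow> real"
    and mu_star sigma_sq_star :: real
  assumes J: "J \<ge> 2" and d: "d \<ge> 1" and I: "I = d * J"
    and payout_distr: "\<And>i. i < I \<Longrightarrow> real_distribution (D i)"
    and payout_bounded: "\<And>i. i < I \<Longrightarrow> \<exists>B. AE x in D i. 0 \<le> x \<and> x \<le> B"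
    and payout_nonzero: "\<And>i. i < I \<Longrightarrow> measure (D i) {x. x \<noteq> 0} = p i"
    and p_bounds: "\<And>i. i < I \<Longrightarrow> 0 < p i \<and> p i < 1"
    and initial_state: "i0 < I" "j0 < J"
    and M: "prob_space M"
    and Rhat_indep: "prob_space.indep_vars M (\<lambda>_. borel) Rhat {1..}"
    and Rhat_distr: "\<And>n. n \<ge> 1 \<Longrightarrow> distr M borel (Rhat n) = D ((i0 + n - 1) mod I)"
    and N: "prob_space N"
    and R_indep: "prob_space.indep_vars N (\<lambda>_. borel) R UNIV"
    and R_distr: "\<And>n. distr N borel (R n) = D (nat ((n - 1) mod int I))"
    and mu_star: "mu_star = mu_bar J I N R / real I"
    and sigma_sq_star: "sigma_sq_star = sigma_sq_bar J I N R / real I"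
    and sigma_pos: "sigma_sq_bar J I N R > 0"
  shows "weak_conv_m
    (\<lambda>n. distr M borel (\<lambda>x.
        ((\<Sum>k=1..n. futurity_payout J j0 (\<lambda>m. Rhat m x) k) - real n * mu_star)
          / sqrt (real n * sigma_sq_star)))
    std_normal_distribution"
proof -
  interpret N: prob_space N by fact
  have I1: "I \<ge> 1" using J d I by (simp add: Suc_le_eq)
  have rv: "R n \<in> borel_measurable N" for n
    using R_indep by (simp add: N.indep_vars_def)
  have idx: "nat ((n - 1) mod int I) < I" for n
    using I1 by (simp add: nat_less_iff)
  obtain b where b: "\<And>i. i < I \<Longrightarrow> AE x in D i. 0 \<le> x \<and> x \<le> b i"
    using payout_bounded by metis
  \<comment> \<open>There are finitely many cam positions, so maxima give a common bound and a
    common loss probability, still below 1 because every p i is positive.\<close>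
  define B where "B = Max (b ` {..<I})"
  define q where "q = Max ((\<lambda>i. 1 - p i) ` {..<I})"
  have ne: "{..<I} \<noteq> {}" using I1 by (simp add: lessThan_empty_iff)
  interpret payout_process N R J I B q
  proof
    show "J \<ge> 2" "I \<ge> 1" "N.indep_vars (\<lambda>_. borel) R UNIV" by fact+
    show "distr N borel (R (n + int I)) = distr N borel (R n)" for n
    proof -
      have "(n + int I - 1) mod int I = (n - 1 + int I) mod int I" by (simp add: algebra_simps)
      also have "\<dots> = (n - 1) mod int I" by (rule mod_add_self2)
      finally show ?thesis by (simp only: R_distr)
    qed
    show "AE x in N. 0 \<le> R n x \<and> R n x \<le> B" for n
    proof -
      have "AE x in distr N borel (R n). 0 \<le> x \<and> x \<le> b (nat ((n - 1) mod int I))"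
        unfolding R_distr by (rule b[OF idx])
      then have "AE x in N. 0 \<le> R n x \<and> R n x \<le> b (nat ((n - 1) mod int I))"
        by (rule AE_distrD[OF rv])
      then show ?thesis
      proof eventually_elim
        case (elim x)
        have "b (nat ((n - 1) mod int I)) \<le> B"
          unfolding B_def using idx by (intro Max_ge) auto
        with elim show ?case by linarith
      qed
    qed
    show "N.prob {x \<in> space N. R n x = 0} \<le> q" for n
    proof -
      let ?i = "nat ((n - 1) mod int I)"
      interpret D: real_distribution "D ?i" by (rule payout_distr[OF idx])
      have "N.prob {x \<in> space N. R n x = 0} = measure (distr N borel (R n)) {0}"
        using rv by (subst measure_distr) (auto intro!: arg_cong[of _ _ N.prob])
      also have "\<dots> = 1 - measure (D ?i) {x. x \<noteq> 0}"
      proof -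
        have "{0} = space (D ?i) - {x. x \<noteq> 0}" by auto
        then show ?thesis unfolding R_distr using D.prob_compl[of "{x. x \<noteq> 0}"] by simp
      qed
      also have "\<dots> = 1 - p ?i" by (simp add: payout_nonzero[OF idx])
      also have "\<dots> \<le> q" unfolding q_def using idx by (intro Max_ge) auto
      finally show ?thesis .
    qed
    show "q < 1" unfolding q_def using p_bounds ne by (subst Max_less_iff) auto
  qed
  have law: "distr M borel (\<lambda>x. ((\<Sum>k=1..n. futurity_payout J j0 (\<lambda>m. Rhat m x) k) - real n * mu_star)
          / sqrt (real n * sigma_sq_star)) =
      distr N borel (\<lambda>x. (payout_sum J j0 (payouts_after (int i0) (\<lambda>m. R m x)) n - real n * mu_star)
        / sqrt (real n * sigma_sq_star))" for n
  proof -
    define f where "f = (\<lambda>s. (payout_sum J j0 s n - real n * mu_star) / sqrt (real n * sigma_sq_star))"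
    \<comment> \<open>The functional ignores the value at index 0, so it factors through the coups
      from 1 on, where independence of \<open>Rhat\<close> is assumed.\<close>
    have f: "f (\<lambda>i\<in>{1..}. s i) = f s" for s
      using payout_sum_cong[of n "\<lambda>i\<in>{1..}. s i" s J j0] by (simp add: f_def)
    have "distr M borel (\<lambda>x. f (\<lambda>i\<in>{1..}. Rhat i x)) = distr N borel (\<lambda>x. f (\<lambda>i\<in>{1..}. R (int i0 + int i) x))"
    proof (rule distr_indep_functional_eq[OF M N _ Rhat_indep])
      show "N.indep_vars (\<lambda>_. borel) (\<lambda>i. R (int i0 + int i)) {1..}"
        by (rule N.indep_vars_reindex[OF R_indep]) (auto simp: inj_on_def)
      have "(\<lambda>s. payout_sum J j0 s n) \<in> borel_measurable (PiM {1..} (\<lambda>_. borel))"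
        by (intro measurable_payout_sum measurable_component_singleton) auto
      then show "f \<in> borel_measurable (PiM {1..} (\<lambda>_. borel))"
        unfolding f_def by measurable
      show "distr M borel (Rhat i) = distr N borel (R (int i0 + int i))" if "i \<in> {1..}" for i
      proof -
        \<comment> \<open>Index n of R is in cam position n - 1 modulo I, so coup i of the machine
          corresponds to time i0 + i.\<close>
        have "int i0 + int i - 1 = int (i0 + i - 1)" using that by auto
        then have "nat ((int i0 + int i - 1) mod int I) = (i0 + i - 1) mod I"
          by (simp only: of_nat_mod[symmetric] nat_int)
        then show ?thesis using that by (simp add: Rhat_distr R_distr)
      qed
    qed auto
    then show ?thesis unfolding f by (simp add: f_def payout_sum_def payouts_after_def)
  qed
  show ?thesis
    unfolding law using payout_sum_clt[OF initial_state(2) sigma_pos, of i0]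
    by (simp only: mu_star sigma_sq_star)
qed

end
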